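(* Let $\mathcal{H}(\mathbb{C}^{\mathbb{N}})$ be the space of entire functions on $\mathbb{C}^{\mathbb{N}}$, endowed with a topology $\tau$ which is either $\tau_0$ or $\tau_\delta$. Every nontrivial convolution operator on $(\mathcal{H}(\mathbb{C}^{\mathbb{N}}),\tau)$ is Li--Yorke chaotic.
   Context: $\mathbb{N}=\{1,2,3,\ldots\}$. $\mathbb{C}^{\mathbb{N}}=\prod_{n=1}^\infty\mathbb{C}$ carries the product topology. $\mathcal{H}(\mathbb{C}^{\mathbb{N}})$ is the complex vector space of all entire functions $f\colon\mathbb{C}^{\mathbb{N}}\to\mathbb{C}$ (holomorphic on the whole locally convex space $\mathbb{C}^{\mathbb{N}}$, i.e. continuous and holomorphic along every complex affine line); $\mathcal{H}(\mathbb{C}^n)$ is the space of entire functions on $\mathbb{C}^n$ with the compact-open topology. Topologies: $\tau_0$ is the compact-open topology on $\mathcal{H}(\mathbb{C}^{\mathbb{N}})$, and $\tau_\delta$ is its associated bornological topology. Equivalently, $\tau_\delta$ is the locally convex inductive limit topology, i.e. the strongest locally convex topology on $\mathcal{H}(\mathbb{C}^{\mathbb{N}})$ making all the maps $\pi_n^*\colon \mathcal{H}(\mathbb{C}^n)\to\mathcal{H}(\mathbb{C}^{\mathbb{N}})$, $\pi_n^*(g)=g\circ\pi_n$ ($n\in\mathbb{N}$), continuous, where $\pi_n\colon\mathbb{C}^{\mathbb{N}}\to\mathbb{C}^n$ is the projection onto the first $n$ coordinates. For $\xi\in\mathbb{C}^{\mathbb{N}}$ the translation operator $\tau_\xi$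 on $\mathcal{H}(\mathbb{C}^{\mathbb{N}})$ is $(\tau_\xi f)(x)=f(x-\xi)$. A convolution operator on $(\mathcal{H}(\mathbb{C}^{\mathbb{N}}),\tau)$ is a continuous linear map $L\colon\mathcal{H}(\mathbb{C}^{\mathbb{N}})\to\mathcal{H}(\mathbb{C}^{\mathbb{N}})$ such that $L(\tau_\xi f)=\tau_\xi(Lf)$ for every $f\in\mathcal{H}(\mathbb{C}^{\mathbb{N}})$ and $\xi\in\mathbb{C}^{\mathbb{N}}$. It is nontrivial if it is not a scalar multiple of the identity. Let $T$ be a continuous linear operator on a Hausdorff topological vector space $E$. A pair $(x,y)\in E\times E$ is a Li--Yorke pair for $T$ if the sequence $(T^n(x-y))_n$ does not converge to zero, but it has a subsequence converging to zero. A scrambled set for $T$ is a subset $S\subset E$ such that $(x,y)$ is a Li--Yorke pair for $T$ whenever $x$ and $y$ are distinct points of $S$. $T$ is Li--Yorke chaotic if there exists an uncountable scrambled set for $T$. *)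

theory Defs
  imports "HOL-Analysis.Analysis"
begin

text \<open>
  The space of all complex sequences is the type \<^typ>\<open>nat \<Rightarrow> complex\<close> with its type-class topology,
  which is the product topology (coordinates are numbered from 0). Complex n-space is identified
  with the linear subspace of sequences supported on the first n coordinates; its subspace topology
  is the usual one. Vector space operations on functions are pointwise.
\<close>

definition cspace :: "nat \<Rightarrow> (nat \<Rightarrow> complex) set" where
  "cspace n = {x. \<forall>i\<ge>n. x i = 0}"

definition proj :: "nat \<Rightarrow> (nat \<Rightarrow> complex) \<Rightarrow> nat \<Rightarrow> complex" where
  "proj n x = (\<lambda>i. if i < n then x i else 0)"

text \<open>
  Entire functions on a linear subspace \<open>E\<close>, used for \<open>E = UNIV\<close> and \<open>E = cspace n\<close>: continuous,
  and holomorphic along every complex affine line of \<open>E\<close>. The last clause only fixes a unique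
  total HOL function representing a function with domain \<open>E\<close>; it is void for \<open>E = UNIV\<close>.
\<close>

definition entire :: "(nat \<Rightarrow> complex) set \<Rightarrow> ((nat \<Rightarrow> complex) \<Rightarrow> complex) set" where
  "entire E = {f. continuous_on E f \<and>
     (\<forall>a\<in>E. \<forall>b\<in>E. (\<lambda>z. f (\<lambda>i. a i + z * b i)) holomorphic_on UNIV) \<and>
     (\<forall>x. x \<notin> E \<longrightarrow> f x = 0)}"

definition compact_open :: "(nat \<Rightarrow> complex) set \<Rightarrow> ((nat \<Rightarrow> complex) \<Rightarrow> complex) topology" where
  "compact_open E = topology_generated_by
     {{f \<in> entire E. f ` K \<subseteq> U} | K U. compact K \<and> K \<subseteq> E \<and> open U}"

definition convex_funset :: "('a \<Rightarrow> complex) set \<Rightarrow> bool" where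
  "convex_funset C \<longleftrightarrow> (\<forall>f\<in>C. \<forall>g\<in>C. \<forall>t::real. 0 \<le> t \<and> t \<le> 1 \<longrightarrow>
     (\<lambda>x. complex_of_real (1 - t) * f x + complex_of_real t * g x) \<in> C)"

definition locally_convex_topology :: "('a \<Rightarrow> complex) set \<Rightarrow> ('a \<Rightarrow> complex) topology \<Rightarrow> bool" where
  "locally_convex_topology V T \<longleftrightarrow>
     topspace T = V \<and>
     continuous_map (prod_topology T T) T (\<lambda>(f, g). \<lambda>x. f x + g x) \<and>
     continuous_map (prod_topology euclidean T) T (\<lambda>(c, f). \<lambda>x. c * f x) \<and>
     (\<forall>U. openin T U \<and> (\<lambda>x. 0) \<in> U \<longrightarrow>
        (\<exists>C. openin T C \<and> (\<lambda>x. 0) \<in> C \<and> convex_funset C \<and> C \<subseteq> U))"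

definition tau_0 :: "((nat \<Rightarrow> complex) \<Rightarrow> complex) topology" where
  "tau_0 = compact_open UNIV"

text \<open>
  The inductive limit topology: the strongest locally convex topology making all pullbacks
  along the projections continuous, given as the supremum of all such topologies (a supremum of
  locally convex topologies is again locally convex, so the supremum is attained). This coincides
  with the bornological topology associated with \<open>tau_0\<close>.
\<close>

definition tau_delta :: "((nat \<Rightarrow> complex) \<Rightarrow> complex) topology" where
  "tau_delta = topology_generated_by
     {U. \<exists>T. locally_convex_topology (entire UNIV) T \<and>
         (\<forall>n\<ge>1. continuous_map (compact_open (cspace n)) T (\<lambda>g. g \<circ> proj n)) \<and>
         openin T U}"

definition translation ::
    "(nat \<Rightarrow> complex) \<Rightarrow> ((nat \<Rightarrow> complex) \<Rightarrow> complex) \<Rightarrow> (nat \<Rightarrow> complex) \<Rightarrow> complex" where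
  "translation \<xi> f = (\<lambda>x. f (\<lambda>i. x i - \<xi> i))"

definition linear_on_funset :: "('a \<Rightarrow> complex) set \<Rightarrow> (('a \<Rightarrow> complex) \<Rightarrow> 'a \<Rightarrow> complex) \<Rightarrow> bool" where
  "linear_on_funset V L \<longleftrightarrow>
     (\<forall>f\<in>V. \<forall>g\<in>V. L (\<lambda>x. f x + g x) = (\<lambda>x. L f x + L g x)) \<and>
     (\<forall>c. \<forall>f\<in>V. L (\<lambda>x. c * f x) = (\<lambda>x. c * L f x))"

definition convolution_operator ::
    "((nat \<Rightarrow> complex) \<Rightarrow> complex) topology \<Rightarrow>
     (((nat \<Rightarrow> complex) \<Rightarrow> complex) \<Rightarrow> (nat \<Rightarrow> complex) \<Rightarrow> complex) \<Rightarrow> bool" where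
  "convolution_operator T L \<longleftrightarrow>
     continuous_map T T L \<and> linear_on_funset (entire UNIV) L \<and>
     (\<forall>f\<in>entire UNIV. \<forall>\<xi>. L (translation \<xi> f) = translation \<xi> (L f))"

definition nontrivial_operator ::
    "(((nat \<Rightarrow> complex) \<Rightarrow> complex) \<Rightarrow> (nat \<Rightarrow> complex) \<Rightarrow> complex) \<Rightarrow> bool" where
  "nontrivial_operator L \<longleftrightarrow> \<not> (\<exists>c. \<forall>f\<in>entire UNIV. L f = (\<lambda>x. c * f x))"

definition li_yorke_pair ::
    "('a \<Rightarrow> complex) topology \<Rightarrow> (('a \<Rightarrow> complex) \<Rightarrow> 'a \<Rightarrow> complex) \<Rightarrow>
     ('a \<Rightarrow> complex) \<Rightarrow> ('a \<Rightarrow> complex) \<Rightarrow> bool" where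
  "li_yorke_pair T L f g \<longleftrightarrow>
     \<not> limitin T (\<lambda>n. (L ^^ n) (\<lambda>x. f x - g x)) (\<lambda>x. 0) sequentially \<and>
     (\<exists>r::nat \<Rightarrow> nat. strict_mono r \<and>
        limitin T (\<lambda>k. (L ^^ r k) (\<lambda>x. f x - g x)) (\<lambda>x. 0) sequentially)"

definition scrambled_set ::
    "('a \<Rightarrow> complex) topology \<Rightarrow> (('a \<Rightarrow> complex) \<Rightarrow> 'a \<Rightarrow> complex) \<Rightarrow> ('a \<Rightarrow> complex) set \<Rightarrow> bool" where
  "scrambled_set T L S \<longleftrightarrow>
     S \<subseteq> topspace T \<and> (\<forall>f\<in>S. \<forall>g\<in>S. f \<noteq> g \<longrightarrow> li_yorke_pair T L f g)"

definition li_yorke_chaotic ::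
    "('a \<Rightarrow> complex) topology \<Rightarrow> (('a \<Rightarrow> complex) \<Rightarrow> 'a \<Rightarrow> complex) \<Rightarrow> bool" where
  "li_yorke_chaotic T L \<longleftrightarrow> (\<exists>S. uncountable S \<and> scrambled_set T L S)"

end

theory Submission
  imports Defs "HOL-Complex_Analysis.Complex_Analysis"
begin

text \<open>
  It suffices to find one entire function \<open>f\<close> that is semi-irregular: its orbit under \<open>L\<close> does not
  converge to 0 but has a subsequence converging to 0. By linearity every nonzero multiple of \<open>f\<close> is
  semi-irregular too, so the real multiples of \<open>f\<close> form an uncountable scrambled set.

  The search for \<open>f\<close> takes place in one complex variable. Every entire function of infinitely many
  variables depends on finitely many coordinates (\<open>entire_in_cylinder\<close>), and on such functions the
  functional \<open>f \<mapsto> L f 0\<close> is bounded by a supremum over a polydisc, for either topology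
  (\<open>functional_at_zero\<close>). An operator commuting with translations has the exponentials of linear
  forms as eigenvectors, and these exponentials span a dense subspace
  (\<open>zero_if_zero_on_exponentials\<close>). Since \<open>L\<close> is nontrivial, its eigenvalues on exponentials cannot
  all be equal, so they form a nonconstant entire function \<open>\<Psi>\<close> along the multiples of some linear
  form \<open>\<phi>\<close>. The operator \<open>L\<close> preserves the functions of the form \<open>g \<circ> \<phi>\<close> and acts on them as an
  operator \<open>A\<close> on entire functions \<open>g\<close> of one variable with \<open>A e\<^sub>z = \<Psi> z e\<^sub>z\<close>, where
  \<open>e\<^sub>z t = exp (z * t)\<close>. By Liouville's theorem \<open>\<Psi>\<close> takes values inside and outside the unit circle.

  Exponentials \<open>e\<^sub>z\<close> with \<open>\<bar>\<Psi> z\<bar> < 1\<close> have orbits converging to 0. Those with \<open>z\<close> in a small disc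
  already approximate every exponential, in particular one with \<open>\<bar>\<Psi> z\<bar> > 1\<close>, whose orbit
  explodes. So there are functions with null orbits that are small for a long time and nevertheless
  become large later (\<open>late_bump\<close>). A sum of such bumps, each one chosen so late and so
  small that it does not disturb the behaviour achieved before, is semi-irregular
  (\<open>semi_irregular_vector\<close>). Composed with \<open>\<phi>\<close> it gives \<open>f\<close>; convergence of the subsequence holds for
  both topologies because the pullbacks of compactly convergent sequences of functions of finitely
  many variables converge, and divergence is detected by evaluation at 0.
\<close>

section \<open>Orbits of operators on entire functions of one variable\<close>

text \<open>The error that makes difference quotients of exponentials converge, uniformly on bounded sets.\<close>

lemma exp_linear_error: "norm (exp w - 1 - w) \<le> exp (norm w) * norm w ^ 2" for w :: complex
proof -
  have "norm (exp w - (\<Sum>k\<le>1. w ^ k / fact k)) \<le> exp \<bar>Re w\<bar> * norm w ^ 2"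
    using Taylor_exp[of w 1] by (simp add: power2_eq_square)
  also have "\<dots> \<le> exp (norm w) * norm w ^ 2"
    using abs_Re_le_cmod[of w] by (intro mult_right_mono) auto
  finally show ?thesis by (simp add: algebra_simps)
qed

text \<open>By Liouville's theorem, applied to \<open>\<Psi>\<close> and to its reciprocal.\<close>

lemma nonconstant_entire_crosses_unit_circle:
  assumes hol: "\<Psi> holomorphic_on UNIV" and "\<Psi> u \<noteq> \<Psi> v"
  obtains a b where "norm (\<Psi> a) < 1" "norm (\<Psi> b) > 1"
proof -
  have "\<exists>b. norm (\<Psi> b) > 1"
  proof (rule ccontr)
    assume "\<not> ?thesis"
    hence "bounded (range \<Psi>)" by (auto simp: bounded_iff not_less)
    from Liouville_theorem[OF hol this] show False using assms(2) by (auto simp: constant_on_def)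
  qed
  moreover have "\<exists>a. norm (\<Psi> a) < 1"
  proof (rule ccontr)
    assume "\<not> ?thesis"
    hence ge: "\<And>a. 1 \<le> norm (\<Psi> a)" by (auto simp: not_less)
    hence nz: "\<And>a. \<Psi> a \<noteq> 0" by (metis norm_zero not_one_le_zero)
    have "(\<lambda>z. inverse (\<Psi> z)) holomorphic_on UNIV" using hol nz by (intro holomorphic_intros) auto
    moreover have "norm (inverse (\<Psi> z)) \<le> 1" for z
      using ge[of z] by (simp add: norm_inverse inverse_le_1_iff)
    hence "bounded (range (\<lambda>z. inverse (\<Psi> z)))" by (auto simp: bounded_iff)
    ultimately have "(\<lambda>z. inverse (\<Psi> z)) constant_on UNIV" by (rule Liouville_theorem)
    hence "inverse (\<Psi> u) = inverse (\<Psi> v)" by (metis UNIV_I constant_on_def)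
    thus False using assms(2) by simp
  qed
  ultimately show ?thesis using that by blast
qed

text \<open>
  The model is a continuous operator commuting with translations: continuity of
  \<open>g \<mapsto> A g 0\<close> controls it by the supremum of \<open>\<bar>g\<bar>\<close> on a disc, and translations carry the
  estimate to every \<open>t\<close> with the same radius and constant.
\<close>

locale locally_bounded_operator =
  fixes A :: "(complex \<Rightarrow> complex) \<Rightarrow> complex \<Rightarrow> complex" and C r :: real
  assumes holo: "g holomorphic_on UNIV \<Longrightarrow> A g holomorphic_on UNIV"
    and add: "\<lbrakk>f holomorphic_on UNIV; g holomorphic_on UNIV\<rbrakk> \<Longrightarrow>
                A (\<lambda>t. f t + g t) = (\<lambda>t. A f t + A g t)"
    and scale: "g holomorphic_on UNIV \<Longrightarrow> A (\<lambda>t. c * g t) = (\<lambda>t. c * A g t)"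
    and bound: "\<lbrakk>g holomorphic_on UNIV; 0 < M; \<And>s. norm (s - t) \<le> r \<Longrightarrow> norm (g s) \<le> M\<rbrakk>
                \<Longrightarrow> norm (A g t) \<le> C * M"
    and C_ge_1: "1 \<le> C" and r_nonneg: "0 \<le> r"
begin

lemma iter_holo: "g holomorphic_on UNIV \<Longrightarrow> (A ^^ k) g holomorphic_on UNIV"
  by (induction k) (auto intro: holo)

lemma iter_add:
  "\<lbrakk>f holomorphic_on UNIV; g holomorphic_on UNIV\<rbrakk> \<Longrightarrow>
   (A ^^ k) (\<lambda>t. f t + g t) = (\<lambda>t. (A ^^ k) f t + (A ^^ k) g t)"
  by (induction k) (auto simp: add iter_holo)

lemma iter_scale:
  "g holomorphic_on UNIV \<Longrightarrow> (A ^^ k) (\<lambda>t. c * g t) = (\<lambda>t. c * (A ^^ k) g t)"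
  by (induction k) (auto simp: scale iter_holo)

lemma iter_diff:
  assumes "f holomorphic_on UNIV" "g holomorphic_on UNIV"
  shows "(A ^^ k) (\<lambda>t. f t - g t) = (\<lambda>t. (A ^^ k) f t - (A ^^ k) g t)"
proof -
  have "(\<lambda>t. f t - g t) = (\<lambda>t. f t + (-1) * g t)" by simp
  thus ?thesis
    using assms iter_add[of f "\<lambda>t. (-1) * g t" k] iter_scale[of g k "-1"]
    by (auto intro: holomorphic_intros)
qed

text \<open>Each application of \<open>A\<close> costs a factor \<open>C\<close> and enlarges the controlling disc by \<open>r\<close>.\<close>

lemma iter_bound:
  assumes "g holomorphic_on UNIV" "0 < M" "\<And>s. norm s \<le> R + k * r \<Longrightarrow> norm (g s) \<le> M"
    and "norm t \<le> R"
  shows "norm ((A ^^ k) g t) \<le> C ^ k * M"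
  using assms(3,4)
proof (induction k arbitrary: R t)
  case 0
  thus ?case by simp
next
  case (Suc k)
  have "norm ((A ^^ k) g s) \<le> C ^ k * M" if "norm (s - t) \<le> r" for s
  proof (rule Suc.IH[of "R + r"])
    show "norm (g u) \<le> M" if "norm u \<le> R + r + real k * r" for u
      using that by (intro Suc.prems) (simp add: algebra_simps)
    show "norm s \<le> R + r"
      using that Suc.prems(2) norm_triangle_sub[of s t] by simp
  qed
  moreover have "0 < C ^ k * M" using C_ge_1 assms(2) by simp
  ultimately show ?case
    using bound[OF iter_holo[OF assms(1)], of "C ^ k * M" t k] by (simp add: mult.assoc)
qed

definition null_orbit :: "(complex \<Rightarrow> complex) \<Rightarrow> bool" where
  "null_orbit g \<longleftrightarrow> g holomorphic_on UNIV \<and>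
     (\<forall>R. \<forall>\<epsilon>>0. \<exists>K. \<forall>k\<ge>K. \<forall>t. norm t \<le> R \<longrightarrow> norm ((A ^^ k) g t) \<le> \<epsilon>)"

text \<open>
  The closure of the space of null orbits in the topology of locally uniform convergence. Its
  members need not have null orbits themselves, which is what makes the construction possible.
\<close>

definition null_closure :: "(complex \<Rightarrow> complex) \<Rightarrow> bool" where
  "null_closure f \<longleftrightarrow> f holomorphic_on UNIV \<and>
     (\<forall>R. \<forall>\<epsilon>>0. \<exists>u. null_orbit u \<and> (\<forall>t. norm t \<le> R \<longrightarrow> norm (f t - u t) \<le> \<epsilon>))"

lemma null_orbit_holo: "null_orbit g \<Longrightarrow> g holomorphic_on UNIV"
  by (simp add: null_orbit_def)

lemma null_orbitD:
  assumes "null_orbit g" "\<epsilon> > 0"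
  obtains K where "\<And>k t. k \<ge> K \<Longrightarrow> norm t \<le> R \<Longrightarrow> norm ((A ^^ k) g t) \<le> \<epsilon>"
  using assms unfolding null_orbit_def by blast

lemma null_orbit_zero: "null_orbit (\<lambda>t. 0)"
proof -
  have "(A ^^ k) (\<lambda>t. 0) = (\<lambda>t. 0)" for k
    using iter_scale[of "\<lambda>t. 0" k 0] by simp
  thus ?thesis by (simp add: null_orbit_def)
qed

lemma null_orbit_add:
  assumes "null_orbit f" "null_orbit g"
  shows "null_orbit (\<lambda>t. f t + g t)"
  unfolding null_orbit_def
proof (intro conjI allI impI)
  show "(\<lambda>t. f t + g t) holomorphic_on UNIV"
    using assms by (intro holomorphic_intros null_orbit_holo)
  fix R \<epsilon> :: real assume "\<epsilon> > 0"
  obtain K where K: "\<And>k t. k \<ge> K \<Longrightarrow> norm t \<le> R \<Longrightarrow> norm ((A ^^ k) f t) \<le> \<epsilon> / 2"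
    using null_orbitD[OF assms(1), of "\<epsilon> / 2" R] \<open>\<epsilon> > 0\<close> by (metis half_gt_zero)
  obtain K' where K': "\<And>k t. k \<ge> K' \<Longrightarrow> norm t \<le> R \<Longrightarrow> norm ((A ^^ k) g t) \<le> \<epsilon> / 2"
    using null_orbitD[OF assms(2), of "\<epsilon> / 2" R] \<open>\<epsilon> > 0\<close> by (metis half_gt_zero)
  have "norm ((A ^^ k) (\<lambda>t. f t + g t) t) \<le> \<epsilon>" if "k \<ge> max K K'" "norm t \<le> R" for k t
    using K[of k t] K'[of k t] that norm_triangle_ineq[of "(A ^^ k) f t" "(A ^^ k) g t"]
    by (simp add: iter_add assms null_orbit_holo)
  thus "\<exists>K. \<forall>k\<ge>K. \<forall>t. norm t \<le> R \<longrightarrow> norm ((A ^^ k) (\<lambda>t. f t + g t) t) \<le> \<epsilon>"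
    by blast
qed

lemma null_orbit_scale:
  assumes "null_orbit g"
  shows "null_orbit (\<lambda>t. c * g t)"
  unfolding null_orbit_def
proof (intro conjI allI impI)
  show "(\<lambda>t. c * g t) holomorphic_on UNIV"
    using assms by (intro holomorphic_intros null_orbit_holo)
  fix R \<epsilon> :: real assume "\<epsilon> > 0"
  hence "\<epsilon> / (norm c + 1) > 0"
    by (simp add: add_nonneg_pos)
  then obtain K where K: "\<And>k t. k \<ge> K \<Longrightarrow> norm t \<le> R \<Longrightarrow> norm ((A ^^ k) g t) \<le> \<epsilon> / (norm c + 1)"
    using null_orbitD[OF assms, of "\<epsilon> / (norm c + 1)" R] by blast
  have "norm ((A ^^ k) (\<lambda>t. c * g t) t) \<le> \<epsilon>" if "k \<ge> K" "norm t \<le> R" for k t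
  proof -
    have "norm ((A ^^ k) (\<lambda>t. c * g t) t) = norm c * norm ((A ^^ k) g t)"
      by (simp add: iter_scale assms null_orbit_holo norm_mult)
    also have "\<dots> \<le> (norm c + 1) * (\<epsilon> / (norm c + 1))"
      using K[OF that] by (intro mult_mono) auto
    also have "\<dots> = \<epsilon>" by (simp add: add_nonneg_eq_0_iff)
    finally show ?thesis .
  qed
  thus "\<exists>K. \<forall>k\<ge>K. \<forall>t. norm t \<le> R \<longrightarrow> norm ((A ^^ k) (\<lambda>t. c * g t) t) \<le> \<epsilon>"
    by blast
qed

lemma null_closure_holo: "null_closure f \<Longrightarrow> f holomorphic_on UNIV"
  by (simp add: null_closure_def)

lemma null_closureD:
  assumes "null_closure f" "\<epsilon> > 0"
  obtains u where "null_orbit u" "\<And>t. norm t \<le> R \<Longrightarrow> norm (f t - u t) \<le> \<epsilon>"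
  using assms unfolding null_closure_def by blast

lemma null_orbit_null_closure: "null_orbit f \<Longrightarrow> null_closure f"
  unfolding null_closure_def by (auto simp: null_orbit_holo intro!: exI[of _ f])

lemma null_closure_add:
  assumes "null_closure f" "null_closure g"
  shows "null_closure (\<lambda>t. f t + g t)"
  unfolding null_closure_def
proof (intro conjI allI impI)
  show "(\<lambda>t. f t + g t) holomorphic_on UNIV"
    using assms by (intro holomorphic_intros null_closure_holo)
  fix R \<epsilon> :: real assume "\<epsilon> > 0"
  obtain u where u: "null_orbit u" "\<And>t. norm t \<le> R \<Longrightarrow> norm (f t - u t) \<le> \<epsilon> / 2"
    using null_closureD[OF assms(1), of "\<epsilon> / 2" R] \<open>\<epsilon> > 0\<close> by (metis half_gt_zero)
  obtain v where v: "null_orbit v" "\<And>t. norm t \<le> R \<Longrightarrow> norm (g t - v t) \<le> \<epsilon> / 2"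
    using null_closureD[OF assms(2), of "\<epsilon> / 2" R] \<open>\<epsilon> > 0\<close> by (metis half_gt_zero)
  have "norm (f t + g t - (u t + v t)) \<le> \<epsilon>" if "norm t \<le> R" for t
    using norm_triangle_ineq[of "f t - u t" "g t - v t"] u(2)[OF that] v(2)[OF that]
    by (simp add: algebra_simps)
  thus "\<exists>u. null_orbit u \<and> (\<forall>t. norm t \<le> R \<longrightarrow> norm (f t + g t - u t) \<le> \<epsilon>)"
    using null_orbit_add[OF u(1) v(1)] by blast
qed

lemma null_closure_scale:
  assumes "null_closure f"
  shows "null_closure (\<lambda>t. c * f t)"
  unfolding null_closure_def
proof (intro conjI allI impI)
  show "(\<lambda>t. c * f t) holomorphic_on UNIV"
    using assms by (intro holomorphic_intros null_closure_holo)
  fix R \<epsilon> :: real assume "\<epsilon> > 0"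
  hence "\<epsilon> / (norm c + 1) > 0" by (simp add: add_nonneg_pos)
  then obtain u where u: "null_orbit u" "\<And>t. norm t \<le> R \<Longrightarrow> norm (f t - u t) \<le> \<epsilon> / (norm c + 1)"
    using null_closureD[OF assms, of "\<epsilon> / (norm c + 1)" R] by blast
  have "norm (c * f t - c * u t) \<le> \<epsilon>" if "norm t \<le> R" for t
  proof -
    have "norm (c * f t - c * u t) = norm c * norm (f t - u t)"
      by (simp add: norm_mult flip: right_diff_distrib)
    also have "\<dots> \<le> (norm c + 1) * (\<epsilon> / (norm c + 1))"
      using u(2)[OF that] by (intro mult_mono) auto
    also have "\<dots> = \<epsilon>" by (simp add: add_nonneg_eq_0_iff)
    finally show ?thesis .
  qed
  thus "\<exists>u. null_orbit u \<and> (\<forall>t. norm t \<le> R \<longrightarrow> norm (c * f t - u t) \<le> \<epsilon>)"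
    using null_orbit_scale[OF u(1)] by blast
qed

lemma null_closure_sum:
  "(\<And>i. i \<in> I \<Longrightarrow> null_closure (f i)) \<Longrightarrow> null_closure (\<lambda>t. \<Sum>i\<in>I. f i t)"
proof (induction I rule: infinite_finite_induct)
  case (insert i I)
  thus ?case using null_closure_add[of "f i" "\<lambda>t. \<Sum>i\<in>I. f i t"] by simp
qed (auto intro: null_orbit_null_closure null_orbit_zero)

lemma null_closure_closed:
  assumes "f holomorphic_on UNIV"
    and "\<And>R \<epsilon>. \<epsilon> > 0 \<Longrightarrow> \<exists>h. null_closure h \<and> (\<forall>t. norm t \<le> R \<longrightarrow> norm (f t - h t) \<le> \<epsilon>)"
  shows "null_closure f"
  unfolding null_closure_def
proof (intro conjI allI impI)
  fix R \<epsilon> :: real assume "\<epsilon> > 0"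
  hence e: "\<epsilon> / 2 > 0" by simp
  obtain h where h: "null_closure h" "\<And>t. norm t \<le> R \<Longrightarrow> norm (f t - h t) \<le> \<epsilon> / 2"
    using assms(2)[OF e] by blast
  obtain u where u: "null_orbit u" "\<And>t. norm t \<le> R \<Longrightarrow> norm (h t - u t) \<le> \<epsilon> / 2"
    using null_closureD[OF h(1) e] by blast
  have "norm (f t - u t) \<le> \<epsilon>" if "norm t \<le> R" for t
    using h(2)[OF that] u(2)[OF that] norm_triangle_ineq[of "f t - h t" "h t - u t"] by simp
  thus "\<exists>u. null_orbit u \<and> (\<forall>t. norm t \<le> R \<longrightarrow> norm (f t - u t) \<le> \<epsilon>)"
    using u(1) by blast
qed fact

end

text \<open>
  Exponentials are eigenvectors of every operator commuting with translations. A contracted one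
  supplies null orbits, an expanded one supplies growth.
\<close>

locale exponential_eigenvectors = locally_bounded_operator +
  fixes \<Psi> :: "complex \<Rightarrow> complex" and a b :: complex
  assumes eigen: "A (\<lambda>t. exp (z * t)) = (\<lambda>t. \<Psi> z * exp (z * t))"
    and cont: "continuous_on UNIV \<Psi>"
    and contracted: "norm (\<Psi> a) < 1" and expanded: "norm (\<Psi> b) > 1"
begin

lemma iter_exp: "(A ^^ k) (\<lambda>t. exp (z * t)) = (\<lambda>t. \<Psi> z ^ k * exp (z * t))"
proof (induction k)
  case (Suc k)
  have "(A ^^ Suc k) (\<lambda>t. exp (z * t)) = A (\<lambda>t. \<Psi> z ^ k * exp (z * t))"
    using Suc by simp
  also have "\<dots> = (\<lambda>t. \<Psi> z ^ k * A (\<lambda>t. exp (z * t)) t)"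
    by (rule scale) (intro holomorphic_intros)
  also have "\<dots> = (\<lambda>t. \<Psi> z ^ Suc k * exp (z * t))"
    by (simp only: eigen) (simp add: mult_ac)
  finally show ?case .
qed simp

lemma norm_exp_le: "norm t \<le> R \<Longrightarrow> norm (exp (z * t)) \<le> exp (norm z * R)" for z t :: complex
  using norm_exp[of "z * t"] mult_left_mono[of "norm t" R "norm z"]
  by (smt (verit) exp_le_cancel_iff norm_ge_zero norm_mult)

lemma null_orbit_exp:
  assumes "norm (\<Psi> z) < 1"
  shows "null_orbit (\<lambda>t. exp (z * t))"
  unfolding null_orbit_def
proof (intro conjI allI impI)
  show "(\<lambda>t. exp (z * t)) holomorphic_on UNIV" by (intro holomorphic_intros)
  fix R \<epsilon> :: real assume "\<epsilon> > 0"
  have "(\<lambda>k. norm (\<Psi> z) ^ k * exp (norm z * R)) \<longlonglongrightarrow> 0"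
    using assms LIMSEQ_power_zero[of "norm (\<Psi> z)"] tendsto_mult_left_zero by fastforce
  from order_tendstoD(2)[OF this \<open>\<epsilon> > 0\<close>]
  obtain K where K: "\<And>k. k \<ge> K \<Longrightarrow> norm (\<Psi> z) ^ k * exp (norm z * R) < \<epsilon>"
    unfolding eventually_sequentially by blast
  have "norm ((A ^^ k) (\<lambda>t. exp (z * t)) t) \<le> \<epsilon>" if "k \<ge> K" "norm t \<le> R" for k t
  proof -
    have "norm ((A ^^ k) (\<lambda>t. exp (z * t)) t) = norm (\<Psi> z) ^ k * norm (exp (z * t))"
      by (simp add: iter_exp norm_mult norm_power)
    also have "\<dots> \<le> norm (\<Psi> z) ^ k * exp (norm z * R)"
      using that by (intro mult_left_mono norm_exp_le) auto
    finally show ?thesis using K[OF that(1)] by simp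
  qed
  thus "\<exists>K. \<forall>k\<ge>K. \<forall>t. norm t \<le> R \<longrightarrow> norm ((A ^^ k) (\<lambda>t. exp (z * t)) t) \<le> \<epsilon>"
    by blast
qed

text \<open>
  The exponents near \<open>z\<close> are contracted as well, so difference quotients in \<open>z\<close> stay in the closure,
  and every differentiation in \<open>z\<close> produces one more factor \<open>t\<close>.
\<close>

lemma null_closure_monomial_exp:
  assumes "norm (\<Psi> z) < 1"
  shows "null_closure (\<lambda>t. t ^ j * exp (z * t))"
  using assms
proof (induction j arbitrary: z)
  case 0
  thus ?case by (simp add: null_orbit_null_closure null_orbit_exp)
next
  case (Suc j)
  have "open {z. norm (\<Psi> z) < 1}"
    using cont by (intro open_Collect_less continuous_intros)
  then obtain d where d: "d > 0" "ball z d \<subseteq> {z. norm (\<Psi> z) < 1}"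
    using Suc.prems openE by blast
  show ?case
  proof (rule null_closure_closed)
    show "(\<lambda>t. t ^ Suc j * exp (z * t)) holomorphic_on UNIV" by (intro holomorphic_intros)
    fix R \<epsilon> :: real assume \<epsilon>: "\<epsilon> > 0"
    define B where "B = \<bar>R\<bar> ^ j * exp (norm z * R) * (exp \<bar>R\<bar> * \<bar>R\<bar>\<^sup>2)"
    have B: "B \<ge> 0" by (simp add: B_def)
    define h where "h = min (min 1 (d / 2)) (\<epsilon> / (B + 1))"
    have h: "0 < h" "h \<le> 1" "h < d" "h * (B + 1) \<le> \<epsilon>"
    proof -
      have e: "\<epsilon> / (B + 1) > 0" using \<epsilon> B by simp
      show "0 < h" "h \<le> 1" "h < d" using d(1) e by (auto simp: h_def)
      have "h * (B + 1) \<le> \<epsilon> / (B + 1) * (B + 1)"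
        using B by (intro mult_right_mono) (auto simp: h_def)
      thus "h * (B + 1) \<le> \<epsilon>" using B by simp
    qed
    define q where "q = (\<lambda>t. t ^ j * exp ((z + of_real h) * t))"
    have "norm (\<Psi> (z + of_real h)) < 1"
      using d(2) h by (auto simp: subset_iff dist_norm)
    hence "null_closure q" unfolding q_def by (rule Suc.IH)
    from null_closure_scale[OF null_closure_add[OF this
        null_closure_scale[OF Suc.IH[OF Suc.prems], of "-1"]], of "1 / of_real h"]
    have 1: "null_closure (\<lambda>t. (q t - t ^ j * exp (z * t)) / of_real h)"
      by simp
    have "norm (t ^ Suc j * exp (z * t) - (q t - t ^ j * exp (z * t)) / of_real h) \<le> \<epsilon>"
      if t: "norm t \<le> R" for t
    proof -
      have R: "R \<ge> 0" using t norm_ge_zero order_trans by blast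
      define w where "w = of_real h * t"
      have nw: "norm w = h * norm t" using h by (simp add: w_def norm_mult)
      have "norm w \<le> R"
        using nw h t mult_mono[of h 1 "norm t" R] by simp
      have "exp ((z + of_real h) * t) = exp (z * t) * exp w"
        by (simp add: w_def exp_add algebra_simps)
      hence "t ^ Suc j * exp (z * t) - (q t - t ^ j * exp (z * t)) / of_real h
          = - (t ^ j * exp (z * t) * (exp w - 1 - w) / of_real h)"
        using h by (simp add: q_def w_def field_simps)
      hence "norm (t ^ Suc j * exp (z * t) - (q t - t ^ j * exp (z * t)) / of_real h)
          = norm t ^ j * norm (exp (z * t)) * norm (exp w - 1 - w) / h"
        using h by (simp add: norm_mult norm_divide norm_power)
      also have "\<dots> \<le> R ^ j * exp (norm z * R) * (exp R * (h * R)\<^sup>2) / h"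
      proof (intro divide_right_mono mult_mono)
        show "norm t ^ j \<le> R ^ j" using t by (intro power_mono) auto
        show "norm (exp (z * t)) \<le> exp (norm z * R)" by (rule norm_exp_le[OF t])
        have "norm (exp w - 1 - w) \<le> exp (norm w) * norm w ^ 2" by (rule exp_linear_error)
        also have "\<dots> \<le> exp R * (h * R)\<^sup>2"
          using \<open>norm w \<le> R\<close> nw t h by (intro mult_mono power_mono) auto
        finally show "norm (exp w - 1 - w) \<le> exp R * (h * R)\<^sup>2" .
      qed (use h R in auto)
      also have "\<dots> = h * B" using h R by (simp add: B_def power2_eq_square field_simps)
      also have "\<dots> \<le> \<epsilon>" using h by (simp add: algebra_simps)
      finally show ?thesis .
    qed
    thus "\<exists>h. null_closure h \<and> (\<forall>t. norm t \<le> R \<longrightarrow> norm (t ^ Suc j * exp (z * t) - h t) \<le> \<epsilon>)"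
      using 1 by blast
  qed
qed

text \<open>
  Every exponential is a locally uniform limit of functions with null orbits: expand
  \<open>exp ((z - a) * t)\<close> into its Taylor series and multiply by \<open>exp (a * t)\<close>. In particular this holds
  for the expanded exponential.
\<close>

lemma null_closure_exp: "null_closure (\<lambda>t. exp (z * t))"
proof (rule null_closure_closed)
  show "(\<lambda>t. exp (z * t)) holomorphic_on UNIV" by (intro holomorphic_intros)
  fix R \<epsilon> :: real assume \<epsilon>: "\<epsilon> > 0"
  define c where "c = z - a"
  define B where "B = exp (norm a * R) * exp (norm c * R)"
  define x where "x = norm c * \<bar>R\<bar>"
  have "(\<lambda>n. inverse (fact n) * x ^ n) \<longlonglongrightarrow> 0"
    by (rule summable_LIMSEQ_zero[OF summable_exp])
  hence "(\<lambda>n. B * (x * (inverse (fact n) * x ^ n))) \<longlonglongrightarrow> 0"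
    by (intro tendsto_mult_right_zero)
  from order_tendstoD(2)[OF this \<epsilon>]
  obtain N where N: "B * (x * (inverse (fact N) * x ^ N)) < \<epsilon>"
    unfolding eventually_sequentially by blast
  define h where "h = (\<lambda>t. \<Sum>j\<le>N. (c ^ j / fact j) * (t ^ j * exp (a * t)))"
  have "null_closure h"
    unfolding h_def
    by (intro null_closure_sum null_closure_scale null_closure_monomial_exp contracted)
  moreover have "norm (exp (z * t) - h t) \<le> \<epsilon>" if t: "norm t \<le> R" for t
  proof -
    have R: "R \<ge> 0" using t norm_ge_zero order_trans by blast
    have ct: "norm (c * t) \<le> norm c * R" using t by (simp add: norm_mult mult_left_mono)
    have "h t = exp (a * t) * (\<Sum>j\<le>N. (c * t) ^ j / fact j)"
      by (simp add: h_def sum_distrib_left power_mult_distrib mult_ac)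
    moreover have "exp (z * t) = exp (a * t) * exp (c * t)"
      by (simp add: c_def algebra_simps flip: exp_add)
    ultimately have "norm (exp (z * t) - h t)
        = norm (exp (a * t)) * norm (exp (c * t) - (\<Sum>j\<le>N. (c * t) ^ j / fact j))"
      by (simp add: norm_mult flip: right_diff_distrib)
    also have "\<dots> \<le> exp (norm a * R) * (exp (norm c * R) * (norm c * R) ^ Suc N / fact N)"
    proof (intro mult_mono norm_exp_le[OF t])
      have "norm (exp (c * t) - (\<Sum>j\<le>N. (c * t) ^ j / fact j))
          \<le> exp \<bar>Re (c * t)\<bar> * norm (c * t) ^ Suc N / fact N" by (rule Taylor_exp)
      also have "\<dots> \<le> exp (norm c * R) * (norm c * R) ^ Suc N / fact N"
        using ct abs_Re_le_cmod[of "c * t"]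
        by (intro divide_right_mono mult_mono power_mono) auto
      finally show "norm (exp (c * t) - (\<Sum>j\<le>N. (c * t) ^ j / fact j))
          \<le> exp (norm c * R) * (norm c * R) ^ Suc N / fact N" .
    qed auto
    also have "\<dots> = B * (x * (inverse (fact N) * x ^ N))"
      using R by (simp add: B_def x_def field_simps)
    finally show ?thesis using N by simp
  qed
  ultimately show "\<exists>h. null_closure h \<and> (\<forall>t. norm t \<le> R \<longrightarrow> norm (exp (z * t) - h t) \<le> \<epsilon>)"
    by blast
qed

text \<open>
  The iterates are not equicontinuous on the space of null orbits. A tiny multiple of the
  expanded exponential stays small up to time \<open>K\<close> and is large at some later time \<open>m\<close>; an
  approximation of it by a function with null orbit, accurate on a disc so large that
  the bound on iterates applies up to time \<open>m\<close>, inherits both properties.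
\<close>

lemma late_bump:
  assumes "\<epsilon> > 0"
  shows "\<exists>u m. null_orbit u \<and> K < m \<and> 2 \<le> norm ((A ^^ m) u 0) \<and>
           (\<forall>k t. k \<le> K \<longrightarrow> norm t \<le> R \<longrightarrow> norm ((A ^^ k) u t) \<le> \<epsilon>)"
proof -
  \<comment> \<open>The scaling makes the eigenvector at most \<open>\<epsilon> / 2\<close> up to time \<open>K\<close> on the disc of radius \<open>R\<close>.\<close>
  define \<delta> where "\<delta> = \<epsilon> / (2 * (norm (\<Psi> b) ^ K * exp (norm b * R)))"
  have b1: "norm (\<Psi> b) > 0" using expanded by linarith
  have \<delta>: "\<delta> > 0" using assms b1 by (simp add: \<delta>_def)
  define v where "v = (\<lambda>t. of_real \<delta> * exp (b * t))"
  have v: "v holomorphic_on UNIV" unfolding v_def by (intro holomorphic_intros)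
  have Av: "(A ^^ k) v t = of_real \<delta> * (\<Psi> b ^ k * exp (b * t))" for k t
    unfolding v_def by (subst iter_scale) (auto simp: iter_exp intro!: holomorphic_intros)
  have small: "norm ((A ^^ k) v t) \<le> \<epsilon> / 2" if "k \<le> K" "norm t \<le> R" for k t
  proof -
    have "norm ((A ^^ k) v t) = \<delta> * (norm (\<Psi> b) ^ k * norm (exp (b * t)))"
      using \<delta> by (simp add: Av norm_mult norm_power)
    also have "\<dots> \<le> \<delta> * (norm (\<Psi> b) ^ K * exp (norm b * R))"
      using that expanded \<delta> by (intro mult_mono power_increasing norm_exp_le) auto
    also have "\<dots> = \<epsilon> / 2" using b1 by (simp add: \<delta>_def)
    finally show ?thesis .
  qed
  obtain m0 where m0: "3 / \<delta> < norm (\<Psi> b) ^ m0"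
    using real_arch_pow[OF expanded] by blast
  define m where "m = max m0 (Suc K)"
  have "3 / \<delta> < norm (\<Psi> b) ^ m"
    using expanded by (intro less_le_trans[OF m0] power_increasing) (auto simp: m_def)
  hence big: "norm ((A ^^ m) v 0) > 3"
    using \<delta> by (simp add: Av norm_mult norm_power field_simps)
  have "m > K" by (simp add: m_def)
  define \<eta> where "\<eta> = min (\<epsilon> / 2) 1 / C ^ m"
  have \<eta>: "\<eta> > 0" using assms C_ge_1 by (simp add: \<eta>_def)
  have "null_closure v" unfolding v_def by (intro null_closure_scale null_closure_exp)
  then obtain u where u: "null_orbit u"
      "\<And>t. norm t \<le> \<bar>R\<bar> + m * r \<Longrightarrow> norm (v t - u t) \<le> \<eta>"
    using null_closureD[OF _ \<eta>] by blast
  have close: "norm ((A ^^ k) v t - (A ^^ k) u t) \<le> min (\<epsilon> / 2) 1"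
    if k: "k \<le> m" and t: "norm t \<le> \<bar>R\<bar>" for k t
  proof -
    have "norm ((A ^^ k) (\<lambda>t. v t - u t) t) \<le> C ^ k * \<eta>"
    proof (rule iter_bound[OF _ \<eta> _ t])
      show "(\<lambda>t. v t - u t) holomorphic_on UNIV"
        using v null_orbit_holo[OF u(1)] by (rule holomorphic_on_diff)
      fix s :: complex assume "norm s \<le> \<bar>R\<bar> + real k * r"
      also have "\<dots> \<le> \<bar>R\<bar> + real m * r"
        using k r_nonneg by (simp add: mult_right_mono)
      finally show "norm (v s - u s) \<le> \<eta>" by (rule u(2))
    qed
    also have "\<dots> \<le> C ^ m * \<eta>"
      using C_ge_1 k \<eta> by (intro mult_right_mono power_increasing) auto
    also have "\<dots> = min (\<epsilon> / 2) 1" using C_ge_1 by (simp add: \<eta>_def)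
    finally show ?thesis by (simp add: iter_diff v null_orbit_holo[OF u(1)])
  qed
  have "2 \<le> norm ((A ^^ m) u 0)"
    using close[of m 0] big norm_triangle_sub[of "(A ^^ m) v 0" "(A ^^ m) u 0"] by simp
  moreover have "norm ((A ^^ k) u t) \<le> \<epsilon>" if "k \<le> K" "norm t \<le> R" for k t
  proof -
    have "norm ((A ^^ k) u t) \<le> norm ((A ^^ k) v t) + norm ((A ^^ k) v t - (A ^^ k) u t)"
      by (metis norm_minus_commute norm_triangle_sub)
    moreover have "norm t \<le> \<bar>R\<bar>" using that by linarith
    ultimately show ?thesis
      using close[of k t] small[OF that] that \<open>m > K\<close> by simp
  qed
  ultimately show ?thesis using u(1) \<open>m > K\<close> by blast
qed

text \<open>
  One step of the gliding hump: perturb \<open>s\<close> so little that its first \<open>k\<close> iterates barely change, yet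
  so that some later iterate is large at 0. It is large because the iterates of \<open>s\<close> have already
  decayed when the bump appears. The new function has a null orbit again, hence it is small at a
  still later time \<open>k'\<close>.
\<close>

lemma next_bump:
  assumes "null_orbit s" and eps: "\<epsilon> > 0"
  shows "\<exists>s' k'. null_orbit s' \<and> k < k' \<and>
     (\<forall>i t. i \<le> k \<longrightarrow> norm t \<le> R \<longrightarrow> norm ((A ^^ i) s' t - (A ^^ i) s t) \<le> \<epsilon>) \<and>
     (\<exists>m. k < m \<and> m \<le> k' \<and> 1 \<le> norm ((A ^^ m) s' 0)) \<and>
     (\<forall>t. norm t \<le> R \<longrightarrow> norm ((A ^^ k') s' t) \<le> \<epsilon>)"
proof -
  obtain K where K: "\<And>i t. i \<ge> K \<Longrightarrow> norm t \<le> 0 \<Longrightarrow> norm ((A ^^ i) s t) \<le> 1"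
    using null_orbitD[OF assms(1), of 1 0] by (metis zero_less_one)
  obtain u m where u: "null_orbit u" "max k K < m" "2 \<le> norm ((A ^^ m) u 0)"
      "\<And>i t. i \<le> max k K \<Longrightarrow> norm t \<le> R \<Longrightarrow> norm ((A ^^ i) u t) \<le> \<epsilon>"
    using late_bump[OF eps, of "max k K" R] by blast
  define s' where "s' = (\<lambda>t. s t + u t)"
  have s': "null_orbit s'" unfolding s'_def by (intro null_orbit_add assms u)
  have A: "(A ^^ i) s' t = (A ^^ i) s t + (A ^^ i) u t" for i t
    unfolding s'_def by (subst iter_add) (auto intro: null_orbit_holo assms u)
  obtain k0 where k0: "\<And>i t. i \<ge> k0 \<Longrightarrow> norm t \<le> R \<Longrightarrow> norm ((A ^^ i) s' t) \<le> \<epsilon>"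
    using null_orbitD[OF s' eps, of R] by blast
  have "1 \<le> norm ((A ^^ m) s' 0)"
    using K[of m 0] u(2,3) norm_triangle_ineq2[of "(A ^^ m) u 0" "- (A ^^ m) s 0"]
    by (simp add: A add.commute)
  thus ?thesis
    using s' u k0 by (intro exI[of _ s'] exI[of _ "max m k0"]) (auto simp: A)
qed

text \<open>
  The limit \<open>g\<close> of the perturbations \<open>s n\<close> shares with \<open>s n\<close>, up to \<open>(1 / 2) ^ n\<close>, all iterates up to
  time \<open>\<kappa> n\<close>. So \<open>g\<close> has large iterates between consecutive times \<open>\<kappa> n\<close>, and small iterates at the
  times \<open>\<kappa> n\<close>.
\<close>

theorem semi_irregular_vector:
  "\<exists>g. g holomorphic_on UNIV \<and> \<not> (\<lambda>k. (A ^^ k) g 0) \<longlonglongrightarrow> 0 \<and>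
     (\<exists>\<kappa>::nat \<Rightarrow> nat. strict_mono \<kappa> \<and>
        (\<forall>R. \<forall>\<epsilon>>0. \<forall>\<^sub>F j in sequentially. \<forall>t. norm t \<le> R \<longrightarrow> norm ((A ^^ \<kappa> j) g t) \<le> \<epsilon>))"
proof -
  have "\<exists>f. \<forall>n. null_orbit (fst (f n)) \<and>
     (snd (f n) < snd (f (Suc n)) \<and>
     (\<forall>i t. i \<le> snd (f n) \<longrightarrow> norm t \<le> real n \<longrightarrow>
        norm ((A ^^ i) (fst (f (Suc n))) t - (A ^^ i) (fst (f n)) t) \<le> (1 / 2) ^ Suc n) \<and>
     (\<exists>m. snd (f n) < m \<and> m \<le> snd (f (Suc n)) \<and> 1 \<le> norm ((A ^^ m) (fst (f (Suc n))) 0)) \<and>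
     (\<forall>t. norm t \<le> real n \<longrightarrow> norm ((A ^^ snd (f (Suc n))) (fst (f (Suc n))) t) \<le> (1 / 2) ^ Suc n))"
  proof (rule dependent_nat_choice)
    show "\<exists>x. null_orbit (fst (x :: (complex \<Rightarrow> complex) \<times> nat))"
      using null_orbit_zero by (intro exI[of _ "(\<lambda>t. 0, 0)"]) simp
    fix x :: "(complex \<Rightarrow> complex) \<times> nat" and n :: nat
    assume "null_orbit (fst x)"
    from next_bump[OF this, of "(1 / 2) ^ Suc n" "snd x" "real n"]
    show "\<exists>y. null_orbit (fst y) \<and> (snd x < snd y \<and>
     (\<forall>i t. i \<le> snd x \<longrightarrow> norm t \<le> real n \<longrightarrow>
        norm ((A ^^ i) (fst y) t - (A ^^ i) (fst x) t) \<le> (1 / 2) ^ Suc n) \<and>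
     (\<exists>m. snd x < m \<and> m \<le> snd y \<and> 1 \<le> norm ((A ^^ m) (fst y) 0)) \<and>
     (\<forall>t. norm t \<le> real n \<longrightarrow> norm ((A ^^ snd y) (fst y) t) \<le> (1 / 2) ^ Suc n))"
      by auto
  qed
  then obtain f where f: "\<And>n. null_orbit (fst (f n))"
     "\<And>n. snd (f n) < snd (f (Suc n))"
     "\<And>n i t. i \<le> snd (f n) \<Longrightarrow> norm t \<le> real n \<Longrightarrow>
        norm ((A ^^ i) (fst (f (Suc n))) t - (A ^^ i) (fst (f n)) t) \<le> (1 / 2) ^ Suc n"
     "\<And>n. \<exists>m. snd (f n) < m \<and> m \<le> snd (f (Suc n)) \<and> 1 \<le> norm ((A ^^ m) (fst (f (Suc n))) 0)"
     "\<And>n t. norm t \<le> real n \<Longrightarrow> norm ((A ^^ snd (f (Suc n))) (fst (f (Suc n))) t) \<le> (1 / 2) ^ Suc n"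
    by blast
  define s where "s n = fst (f n)" for n
  define \<kappa> where "\<kappa> n = snd (f n)" for n
  note f = f[folded s_def \<kappa>_def]
  have mono: "strict_mono \<kappa>" using f(2) by (simp add: strict_mono_Suc_iff)
  have tail: "norm ((A ^^ i) (s l) t - (A ^^ i) (s n) t) \<le> (1 / 2) ^ n - (1 / 2) ^ l"
    if "n \<le> l" "i \<le> \<kappa> n" "norm t \<le> real n" for n l i t
    using that(1)
  proof (induction l rule: dec_induct)
    case (step l)
    have "\<kappa> n \<le> \<kappa> l" using step(1) mono by (simp add: strict_mono_less_eq)
    hence "norm ((A ^^ i) (s (Suc l)) t - (A ^^ i) (s l) t) \<le> (1 / 2) ^ Suc l"
      using that step(1) by (intro f(3)) auto
    thus ?case
      using step(3) norm_triangle_ineq[of "(A ^^ i) (s (Suc l)) t - (A ^^ i) (s l) t"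
          "(A ^^ i) (s l) t - (A ^^ i) (s n) t"] by simp
  qed simp
  have tail_le: "norm ((A ^^ i) (s l) t - (A ^^ i) (s n) t) \<le> (1 / 2) ^ n"
    if "n \<le> l" "i \<le> \<kappa> n" "norm t \<le> real n" for n l i t
    using tail[OF that] by (smt (verit) zero_le_power divide_nonneg_nonneg)
  have half: "(\<lambda>n. (1 / 2 :: real) ^ n) \<longlonglongrightarrow> 0" by (intro LIMSEQ_power_zero) simp
  have "convergent (\<lambda>l. s l t)" for t
  proof (rule Cauchy_convergent, rule CauchyI)
    fix \<epsilon> :: real assume "\<epsilon> > 0"
    hence "\<epsilon> / 2 > 0" by simp
    from order_tendstoD(2)[OF half this] obtain N0
      where N0: "\<And>n. n \<ge> N0 \<Longrightarrow> (1 / 2 :: real) ^ n < \<epsilon> / 2"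
      unfolding eventually_sequentially by blast
    define N where "N = max N0 (nat \<lceil>norm t\<rceil>)"
    have N: "(1 / 2 :: real) ^ N < \<epsilon> / 2" "norm t \<le> real N"
      using N0[of N] by (auto simp: N_def) linarith
    have "norm (s l t - s l' t) < \<epsilon>" if "l \<ge> N" "l' \<ge> N" for l l'
    proof -
      have "norm (s l t - s N t) \<le> (1 / 2) ^ N" "norm (s l' t - s N t) \<le> (1 / 2) ^ N"
        using tail_le[of N l 0 t] tail_le[of N l' 0 t] that N by auto
      thus ?thesis using N(1) norm_triangle_ineq4[of "s l t - s N t" "s l' t - s N t"] by simp
    qed
    thus "\<exists>M. \<forall>m\<ge>M. \<forall>n\<ge>M. norm (s m t - s n t) < \<epsilon>" by blast
  qed
  then obtain g where g: "\<And>t. (\<lambda>l. s l t) \<longlonglongrightarrow> g t"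
    unfolding convergent_def by metis
  have near: "norm (g t - s n t) \<le> (1 / 2) ^ n" if "norm t \<le> real n" for n t
  proof (rule LIMSEQ_le_const2)
    show "(\<lambda>l. norm (s l t - s n t)) \<longlonglongrightarrow> norm (g t - s n t)"
      by (intro tendsto_intros g)
    show "\<exists>N. \<forall>l\<ge>N. norm (s l t - s n t) \<le> (1 / 2) ^ n"
      using tail_le[of n _ 0 t] that by auto
  qed
  have holo_s: "s n holomorphic_on UNIV" for n using f(1) by (rule null_orbit_holo)
  have holo_g: "g holomorphic_on UNIV"
  proof (rule holomorphic_uniform_sequence[OF open_UNIV holo_s])
    fix x :: complex
    have "uniform_limit (cball x 1) s g sequentially"
      unfolding uniform_limit_sequentially_iff
    proof (intro allI impI)
      fix \<epsilon> :: real assume "\<epsilon> > 0"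
      from order_tendstoD(2)[OF half this] obtain N0
        where N0: "\<And>n. n \<ge> N0 \<Longrightarrow> (1 / 2 :: real) ^ n < \<epsilon>"
        unfolding eventually_sequentially by blast
      have "dist (s n t) (g t) < \<epsilon>" if "n \<ge> max N0 (nat \<lceil>norm x + 1\<rceil>)" "t \<in> cball x 1" for n t
      proof -
        have "norm t \<le> norm x + 1"
          using that(2) norm_triangle_sub[of t x] by (simp add: dist_norm norm_minus_commute)
        hence "norm t \<le> real n" using that(1) by linarith
        from near[OF this] N0[of n] that(1) show ?thesis
          by (simp add: dist_norm norm_minus_commute)
      qed
      thus "\<exists>N. \<forall>n\<ge>N. \<forall>t\<in>cball x 1. dist (s n t) (g t) < \<epsilon>" by blast
    qed
    thus "\<exists>d>0. cball x d \<subseteq> UNIV \<and> uniform_limit (cball x d) s g sequentially"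
      by (intro exI[of _ 1]) simp
  qed
  \<comment> \<open>Each single iterate is continuous for locally uniform convergence.\<close>
  have lim: "(\<lambda>l. (A ^^ i) (s l) t) \<longlonglongrightarrow> (A ^^ i) g t" for i t
  proof (rule LIM_zero_cancel, rule Lim_null_comparison)
    show "(\<lambda>l. C ^ i * (1 / 2) ^ l) \<longlonglongrightarrow> 0"
      using half by (rule tendsto_mult_right_zero)
    have "norm ((A ^^ i) (s l) t - (A ^^ i) g t) \<le> C ^ i * (1 / 2) ^ l"
      if "l \<ge> nat \<lceil>norm t + i * r\<rceil>" for l
    proof -
      have "norm ((A ^^ i) (\<lambda>t. s l t - g t) t) \<le> C ^ i * (1 / 2) ^ l"
      proof (rule iter_bound[of _ _ "norm t"])
        show "(\<lambda>t. s l t - g t) holomorphic_on UNIV" by (intro holomorphic_on_diff holo_s holo_g)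
        fix u :: complex assume "norm u \<le> norm t + real i * r"
        hence "norm u \<le> real l" using that by linarith
        thus "norm (s l u - g u) \<le> (1 / 2) ^ l" using near by (simp add: norm_minus_commute)
      qed auto
      thus ?thesis by (simp add: iter_diff holo_s holo_g)
    qed
    thus "\<forall>\<^sub>F l in sequentially. norm ((A ^^ i) (s l) t - (A ^^ i) g t) \<le> C ^ i * (1 / 2) ^ l"
      unfolding eventually_sequentially by blast
  qed
  have iter_near: "norm ((A ^^ i) g t - (A ^^ i) (s n) t) \<le> (1 / 2) ^ n"
    if "i \<le> \<kappa> n" "norm t \<le> real n" for i n t
  proof (rule LIMSEQ_le_const2)
    show "(\<lambda>l. norm ((A ^^ i) (s l) t - (A ^^ i) (s n) t)) \<longlonglongrightarrow> norm ((A ^^ i) g t - (A ^^ i) (s n) t)"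
      by (intro tendsto_intros lim)
    show "\<exists>N. \<forall>l\<ge>N. norm ((A ^^ i) (s l) t - (A ^^ i) (s n) t) \<le> (1 / 2) ^ n"
      using tail_le that by blast
  qed
  have "\<not> (\<lambda>k. (A ^^ k) g 0) \<longlonglongrightarrow> 0"
  proof
    assume "(\<lambda>k. (A ^^ k) g 0) \<longlonglongrightarrow> 0"
    hence "(\<lambda>k. norm ((A ^^ k) g 0)) \<longlonglongrightarrow> 0" by (rule tendsto_norm_zero)
    hence "\<forall>\<^sub>F k in sequentially. norm ((A ^^ k) g 0) < 1 / 2"
      by (rule order_tendstoD) simp
    then obtain N where N: "\<And>k. k \<ge> N \<Longrightarrow> norm ((A ^^ k) g 0) < 1 / 2"
      unfolding eventually_sequentially by blast
    obtain m where m: "\<kappa> N < m" "m \<le> \<kappa> (Suc N)" "1 \<le> norm ((A ^^ m) (s (Suc N)) 0)"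
      using f(4) by blast
    have "N \<le> m" using m(1) seq_suble[OF mono, of N] by linarith
    hence "norm ((A ^^ m) g 0) < 1 / 2" by (rule N)
    moreover have "norm ((A ^^ m) g 0 - (A ^^ m) (s (Suc N)) 0) \<le> (1 / 2) ^ Suc N"
      using m(2) by (intro iter_near) auto
    moreover have "(1 / 2 :: real) ^ Suc N \<le> 1 / 2"
      using power_le_one[of "1 / 2 :: real" N] by simp
    ultimately show False
      using m(3) norm_triangle_sub[of "(A ^^ m) (s (Suc N)) 0" "(A ^^ m) g 0"]
      by (simp add: norm_minus_commute)
  qed
  moreover have "\<forall>\<^sub>F j in sequentially. \<forall>t. norm t \<le> R \<longrightarrow> norm ((A ^^ \<kappa> (Suc j)) g t) \<le> \<epsilon>"
    if "\<epsilon> > 0" for R \<epsilon>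
  proof -
    from order_tendstoD(2)[OF half that] obtain N0
      where N0: "\<And>n. n \<ge> N0 \<Longrightarrow> (1 / 2 :: real) ^ n < \<epsilon>"
      unfolding eventually_sequentially by blast
    have "norm ((A ^^ \<kappa> (Suc j)) g t) \<le> \<epsilon>" if j: "j \<ge> max N0 (nat \<lceil>R\<rceil>)" and t: "norm t \<le> R" for j t
    proof -
      have "norm t \<le> real j" using j t by linarith
      hence "norm ((A ^^ \<kappa> (Suc j)) (s (Suc j)) t) \<le> (1 / 2) ^ Suc j"
        "norm ((A ^^ \<kappa> (Suc j)) g t - (A ^^ \<kappa> (Suc j)) (s (Suc j)) t) \<le> (1 / 2) ^ Suc j"
        using f(5) by (auto intro: iter_near simp del: power_Suc)
      thus ?thesis
        using N0[of j] j norm_triangle_sub[of "(A ^^ \<kappa> (Suc j)) g t" "(A ^^ \<kappa> (Suc j)) (s (Suc j)) t"]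
        by simp
    qed
    thus ?thesis unfolding eventually_sequentially by blast
  qed
  moreover have "strict_mono (\<lambda>j. \<kappa> (Suc j))"
    using mono by (simp add: strict_mono_def)
  ultimately show ?thesis using holo_g by blast
qed

end

section \<open>Entire functions\<close>

lemma entire_UNIV_iff:
  "f \<in> entire UNIV \<longleftrightarrow> continuous_on UNIV f \<and>
     (\<forall>a b. (\<lambda>z. f (\<lambda>i. a i + z * b i)) holomorphic_on UNIV)"
  by (auto simp: entire_def)

lemma entire_const: "(\<lambda>x. c) \<in> entire UNIV"
  by (simp add: entire_UNIV_iff)

lemma entire_coord: "(\<lambda>x. x i) \<in> entire UNIV"
  by (auto simp: entire_UNIV_iff intro!: holomorphic_intros)

lemma entire_add: "f \<in> entire UNIV \<Longrightarrow> g \<in> entire UNIV \<Longrightarrow> (\<lambda>x. f x + g x) \<in> entire UNIV"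
  by (auto simp: entire_UNIV_iff intro!: holomorphic_intros continuous_intros)

lemma entire_mult: "f \<in> entire UNIV \<Longrightarrow> g \<in> entire UNIV \<Longrightarrow> (\<lambda>x. f x * g x) \<in> entire UNIV"
  by (auto simp: entire_UNIV_iff intro!: holomorphic_intros continuous_intros)

lemma entire_sum:
  "(\<And>i. i \<in> I \<Longrightarrow> f i \<in> entire UNIV) \<Longrightarrow> (\<lambda>x. \<Sum>i\<in>I. f i x) \<in> entire UNIV"
  by (induction I rule: infinite_finite_induct) (auto intro: entire_add entire_const)

lemma entire_compose_holomorphic:
  assumes "g holomorphic_on UNIV" "f \<in> entire UNIV"
  shows "(\<lambda>x. g (f x)) \<in> entire UNIV"
proof -
  have "continuous_on UNIV (\<lambda>x. g (f x))"
    using assms holomorphic_on_imp_continuous_on[of g UNIV] continuous_on_compose2[of UNIV g UNIV f]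
    by (auto simp: entire_UNIV_iff)
  moreover have "(\<lambda>z. g (f (\<lambda>i. a i + z * b i))) holomorphic_on UNIV" for a b
    using assms holomorphic_on_compose_gen[of "\<lambda>z. f (\<lambda>i. a i + z * b i)" UNIV g UNIV]
    by (auto simp: entire_UNIV_iff o_def)
  ultimately show ?thesis by (simp add: entire_UNIV_iff)
qed

lemma entire_compose_affine:
  assumes "f \<in> entire UNIV" "continuous_on UNIV p"
    and "\<And>a b. \<exists>a' b'. \<forall>z. p (\<lambda>i. a i + z * b i) = (\<lambda>i. a' i + z * b' i)"
  shows "(\<lambda>x. f (p x)) \<in> entire UNIV"
proof -
  have "continuous_on UNIV (\<lambda>x. f (p x))"
    using assms continuous_on_compose2[of UNIV f UNIV p] by (auto simp: entire_UNIV_iff)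
  moreover have "(\<lambda>z. f (p (\<lambda>i. a i + z * b i))) holomorphic_on UNIV" for a b
  proof -
    obtain a' b' where "\<forall>z. p (\<lambda>i. a i + z * b i) = (\<lambda>i. a' i + z * b' i)"
      using assms(3) by blast
    thus ?thesis using assms(1) by (simp add: entire_UNIV_iff)
  qed
  ultimately show ?thesis by (simp add: entire_UNIV_iff)
qed

lemma continuous_on_coord: "continuous_on S (\<lambda>x. x i :: 'b :: topological_space)"
  by (rule continuous_on_subset[OF continuous_on_product_coordinates]) simp

lemma continuous_on_proj: "continuous_on S (proj n)"
  unfolding proj_def
proof (rule continuous_on_coordinatewise_then_product)
  show "continuous_on S (\<lambda>x. if i < n then x i else 0)" for i
    by (cases "i < n") (auto intro: continuous_on_coord)
qed

lemma proj_line: "proj n (\<lambda>i. a i + z * b i) = (\<lambda>i. proj n a i + z * proj n b i)"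
  by (auto simp: proj_def)

lemma proj_in_cspace: "proj n x \<in> cspace n"
  by (simp add: proj_def cspace_def)

lemma proj_proj: "m \<le> n \<Longrightarrow> proj m (proj n x) = proj m x"
  by (auto simp: proj_def)

lemma entire_translation:
  assumes "f \<in> entire UNIV"
  shows "translation \<xi> f \<in> entire UNIV"
  unfolding translation_def
proof (rule entire_compose_affine[OF assms])
  show "continuous_on UNIV (\<lambda>x i. x i - \<xi> i)"
    by (intro continuous_intros continuous_on_coord)
  show "\<exists>a' b'. \<forall>z. (\<lambda>i. a i + z * b i - \<xi> i) = (\<lambda>i. a' i + z * b' i)" for a b
    by (rule exI[of _ "\<lambda>i. a i - \<xi> i"], rule exI[of _ b]) (auto simp: algebra_simps)
qed

lemma entire_pullback:
  assumes "g \<in> entire (cspace n)"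
  shows "g \<circ> proj n \<in> entire UNIV"
proof -
  have "continuous_on UNIV (g \<circ> proj n)"
    using continuous_on_compose2[of "cspace n" g UNIV "proj n"] assms
    by (simp add: entire_def o_def continuous_on_proj proj_in_cspace image_subset_iff)
  moreover have "(\<lambda>z. g (proj n (\<lambda>i. a i + z * b i))) holomorphic_on UNIV" for a b
    unfolding proj_line using assms proj_in_cspace by (simp add: entire_def)
  ultimately show ?thesis by (simp add: entire_UNIV_iff)
qed

section \<open>Functions of finitely many coordinates\<close>

definition cylinder :: "nat \<Rightarrow> ((nat \<Rightarrow> complex) \<Rightarrow> complex) set" where
  "cylinder n = {f \<in> entire UNIV. \<forall>x. f (proj n x) = f x}"

lemma cylinder_entire: "f \<in> cylinder n \<Longrightarrow> f \<in> entire UNIV"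
  and cylinder_proj: "f \<in> cylinder n \<Longrightarrow> f (proj n x) = f x"
  by (auto simp: cylinder_def)

lemma cylinder_mono: "m \<le> n \<Longrightarrow> cylinder m \<subseteq> cylinder n"
  unfolding cylinder_def by auto (metis proj_proj)

lemma cylinder_const: "(\<lambda>x. c) \<in> cylinder n"
  by (simp add: cylinder_def entire_const)

lemma cylinder_coord: "i < n \<Longrightarrow> (\<lambda>x. x i) \<in> cylinder n"
  using entire_coord by (auto simp: cylinder_def proj_def)

lemma cylinder_add: "f \<in> cylinder n \<Longrightarrow> g \<in> cylinder n \<Longrightarrow> (\<lambda>x. f x + g x) \<in> cylinder n"
  by (auto simp: cylinder_def entire_add)

lemma cylinder_mult: "f \<in> cylinder n \<Longrightarrow> g \<in> cylinder n \<Longrightarrow> (\<lambda>x. f x * g x) \<in> cylinder n"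
  by (auto simp: cylinder_def entire_mult)

lemma cylinder_diff: "f \<in> cylinder n \<Longrightarrow> g \<in> cylinder n \<Longrightarrow> (\<lambda>x. f x - g x) \<in> cylinder n"
  using cylinder_add[of f n "\<lambda>x. (-1) * g x"] cylinder_mult[OF cylinder_const, of g n "-1"] by simp

lemma cylinder_sum:
  "(\<And>i. i \<in> I \<Longrightarrow> f i \<in> cylinder n) \<Longrightarrow> (\<lambda>x. \<Sum>i\<in>I. f i x) \<in> cylinder n"
  by (auto simp: cylinder_def entire_sum)

lemma cylinder_compose_holomorphic:
  "g holomorphic_on UNIV \<Longrightarrow> f \<in> cylinder n \<Longrightarrow> (\<lambda>x. g (f x)) \<in> cylinder n"
  by (auto simp: cylinder_def entire_compose_holomorphic)

lemma cylinder_exp: "f \<in> cylinder n \<Longrightarrow> (\<lambda>x. exp (f x)) \<in> cylinder n"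
  by (rule cylinder_compose_holomorphic) (auto intro: holomorphic_intros)

text \<open>
  Continuity at the origin bounds \<open>f\<close> near the origin, with no restriction on the coordinates
  beyond some \<open>n\<close>. By Liouville, \<open>f\<close> is constant in all those directions, first near the origin
  and then everywhere by the identity theorem on the complex line through the origin and \<open>x\<close>.
\<close>

lemma entire_in_cylinder:
  assumes f: "f \<in> entire UNIV"
  shows "\<exists>n\<ge>1. f \<in> cylinder n"
proof -
  have cont: "continuous_on UNIV f"
    and hol: "\<And>a b. (\<lambda>z. f (\<lambda>i. a i + z * b i)) holomorphic_on UNIV"
    using f by (auto simp: entire_UNIV_iff)
  have "open (f -` ball (f (\<lambda>_. 0)) 1)"
    using cont by (rule open_vimage[OF open_ball])
  hence "openin (product_topology (\<lambda>_. euclidean) UNIV) (f -` ball (f (\<lambda>_. 0)) 1)"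
    by (simp add: open_fun_def)
  from product_topology_open_contains_basis[OF this, of "\<lambda>_. 0"]
  obtain X where X: "(\<lambda>_. 0) \<in> Pi\<^sub>E UNIV X" "\<And>i. open (X i)" "finite {i. X i \<noteq> UNIV}"
      "Pi\<^sub>E UNIV X \<subseteq> f -` ball (f (\<lambda>_. 0)) 1"
    by auto
  obtain n where "\<forall>i\<in>{i. X i \<noteq> UNIV}. i < n"
    using X(3) finite_nat_set_iff_bounded by blast
  hence XU: "X i = UNIV" if "i \<ge> Suc n" for i
    using that by force
  \<comment> \<open>Inside the neighbourhood of 0 the tail coordinates do not matter.\<close>
  have near: "f (proj (Suc n) x) = f x" if "x \<in> Pi\<^sub>E UNIV X" for x
  proof -
    define b where "b = (\<lambda>i. x i - proj (Suc n) x i)"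
    have "(\<lambda>i. proj (Suc n) x i + z * b i) \<in> Pi\<^sub>E UNIV X" for z
    proof -
      have "proj (Suc n) x i + z * b i \<in> X i" for i
        using that XU[of i] by (cases "i < Suc n") (auto simp: proj_def b_def PiE_iff)
      thus ?thesis by (auto simp: PiE_iff)
    qed
    hence "f (\<lambda>i. proj (Suc n) x i + z * b i) \<in> ball (f (\<lambda>_. 0)) 1" for z
      using X(4) by (metis subsetD vimageE)
    hence "bounded (range (\<lambda>z. f (\<lambda>i. proj (Suc n) x i + z * b i)))"
      by (intro bounded_subset[OF bounded_ball]) blast
    from Liouville_theorem[OF hol this] obtain c
      where c: "\<And>z. f (\<lambda>i. proj (Suc n) x i + z * b i) = c"
      by (auto simp: constant_on_def)
    show ?thesis using c[of 0] c[of 1] by (simp add: b_def)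
  qed
  have "f (proj (Suc n) x) = f x" for x
  proof -
    define g where "g z = f (\<lambda>i. 0 + z * x i) - f (\<lambda>i. 0 + z * proj (Suc n) x i)" for z
    have g: "g holomorphic_on UNIV"
      unfolding g_def by (intro holomorphic_on_diff hol)
    define p where "p = (\<lambda>z::complex. (\<lambda>i. z * x i))"
    have pc: "continuous_on UNIV p"
      unfolding p_def by (intro continuous_intros)
    define S where "S = p -` Pi\<^sub>E UNIV X"
    have "open S"
      unfolding S_def using X(2,3) pc by (intro open_vimage open_PiE) auto
    moreover have "0 \<in> S" using X(1) by (simp add: S_def p_def)
    moreover have "g z = 0" if "z \<in> S" for z
    proof -
      have "proj (Suc n) (p z) = (\<lambda>i. z * proj (Suc n) x i)"
        by (auto simp: proj_def p_def)
      thus ?thesis using near[of "p z"] that by (simp add: S_def g_def p_def)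
    qed
    ultimately have "g 1 = 0"
      using analytic_continuation_open[of S UNIV g "\<lambda>_. 0" 1] g
      by (auto intro: holomorphic_intros)
    thus ?thesis by (simp add: g_def)
  qed
  thus ?thesis using f by (intro exI[of _ "Suc n"]) (auto simp: cylinder_def)
qed

section \<open>The topologies on spaces of entire functions\<close>

lemma topspace_compact_open: "topspace (compact_open E) = entire E"
proof -
  have "\<exists>A\<in>{{f \<in> entire E. f ` K \<subseteq> U} | K U. compact K \<and> K \<subseteq> E \<and> open U}. f \<in> A"
    if "f \<in> entire E" for f
    using that by (intro bexI[of _ "{f \<in> entire E. f ` {} \<subseteq> UNIV}"]) blast+
  thus ?thesis unfolding compact_open_def by auto
qed

text \<open>
  A finite intersection of generating sets is reached by uniting the compact sets and taking the
  least radius. A single one imposes no condition if \<open>K\<close> is empty; otherwise \<open>U\<close> contains 0,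
  hence a disc around 0.
\<close>

lemma compact_open_zero_nhd:
  assumes "openin (compact_open E) W" "(\<lambda>x. 0) \<in> W"
  shows "\<exists>K \<epsilon>. compact K \<and> K \<subseteq> E \<and> 0 < \<epsilon> \<and>
           (\<forall>f\<in>entire E. (\<forall>x\<in>K. norm (f x) < \<epsilon>) \<longrightarrow> f \<in> W)"
proof -
  have "generate_topology_on {{f \<in> entire E. f ` K \<subseteq> U} | K U. compact K \<and> K \<subseteq> E \<and> open U} W"
    using assms(1) openin_topology_generated_by unfolding compact_open_def by blast
  thus ?thesis using assms(2)
  proof induction
    case Empty
    thus ?case by simp
  next
    case (Int a b)
    then obtain K \<epsilon> K' \<epsilon>' where
      *: "compact K" "K \<subseteq> E" "0 < \<epsilon>" "\<forall>f\<in>entire E. (\<forall>x\<in>K. norm (f x) < \<epsilon>) \<longrightarrow> f \<in> a"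
      "compact K'" "K' \<subseteq> E" "0 < \<epsilon>'" "\<forall>f\<in>entire E. (\<forall>x\<in>K'. norm (f x) < \<epsilon>') \<longrightarrow> f \<in> b"
      by (smt (verit) IntE)
    show ?case
      using * by (intro exI[of _ "K \<union> K'"] exI[of _ "min \<epsilon> \<epsilon>'"]) (auto intro: compact_Un)
  next
    case (UN \<K>)
    then obtain k where "k \<in> \<K>" "(\<lambda>x. 0) \<in> k" by blast
    with UN.IH[of k] show ?case by (meson UnionI)
  next
    case (Basis s)
    then obtain K U where s: "s = {f \<in> entire E. f ` K \<subseteq> U}" "compact K" "K \<subseteq> E" "open U"
      by blast
    show ?case
    proof (cases "K = {}")
      case True
      thus ?thesis using s by (intro exI[of _ "{}"] exI[of _ 1]) auto
    next
      case False
      hence "0 \<in> U" using Basis s by auto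
      then obtain \<epsilon> where "0 < \<epsilon>" "ball 0 \<epsilon> \<subseteq> U"
        using \<open>open U\<close> openE by blast
      thus ?thesis using s
        by (intro exI[of _ K] exI[of _ \<epsilon>]) (auto simp: subset_iff)
    qed
  qed
qed

lemma openin_compact_open_eval:
  assumes "x \<in> E" "open U"
  shows "openin (compact_open E) {f \<in> entire E. f x \<in> U}"
proof -
  have "{f \<in> entire E. f x \<in> U} = {f \<in> entire E. f ` {x} \<subseteq> U}" by auto
  thus ?thesis unfolding compact_open_def
    using assms by (intro topology_generated_by_Basis) (auto intro!: exI[of _ "{x}"] exI[of _ U])
qed

lemma continuous_map_eval_compact_open:
  assumes "x \<in> E"
  shows "continuous_map (compact_open E) euclidean (\<lambda>f. f x)"
  using openin_compact_open_eval[OF assms]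
  by (simp add: continuous_map_def topspace_compact_open)

text \<open>
  The topology of pointwise convergence is locally convex and makes the pullbacks continuous, so
  it is coarser than \<^const>\<open>tau_delta\<close>. This is how \<^const>\<open>tau_delta\<close> is seen to have continuous
  evaluations.
\<close>

lemma locally_convex_pointwise:
  "locally_convex_topology (entire UNIV) (top_of_set (entire UNIV))"
  unfolding locally_convex_topology_def
proof (intro conjI allI impI)
  let ?H = "entire UNIV"
  let ?P = "top_of_set ?H"
  show "topspace ?P = ?H" by simp
  have fst_c: "continuous_on A (\<lambda>p. fst p x)"
    for A :: "(((nat \<Rightarrow> complex) \<Rightarrow> complex) \<times> ((nat \<Rightarrow> complex) \<Rightarrow> complex)) set" and x
    by (rule continuous_on_product_then_coordinatewise[of A fst x]) (intro continuous_intros)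
  have snd_c: "continuous_on A (\<lambda>p. snd p x)"
    for A :: "('b :: topological_space \<times> ((nat \<Rightarrow> complex) \<Rightarrow> complex)) set" and x
    by (rule continuous_on_product_then_coordinatewise[of A snd x]) (intro continuous_intros)
  show "continuous_map (prod_topology ?P ?P) ?P (\<lambda>(f, g). \<lambda>x. f x + g x)"
  proof -
    have "continuous_on (?H \<times> ?H) (\<lambda>(f, g). \<lambda>x. f x + g x)"
      unfolding case_prod_beta by (intro continuous_intros fst_c snd_c)
    thus ?thesis
      by (auto simp: prod_topology_subtopology_eu continuous_map_in_subtopology entire_add)
  qed
  show "continuous_map (prod_topology euclidean ?P) ?P (\<lambda>(c, f). \<lambda>x. c * f x)"
  proof -
    have "continuous_on (UNIV \<times> ?H) (\<lambda>(c, f). \<lambda>x. c * f x)"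
      unfolding case_prod_beta by (intro continuous_intros snd_c)
    moreover have "prod_topology euclidean ?P = top_of_set (UNIV \<times> ?H)"
      by (metis prod_topology_subtopology_eu subtopology_UNIV)
    ultimately have "continuous_map (prod_topology euclidean ?P) euclidean (\<lambda>(c, f). \<lambda>x. c * f x)"
      by (metis continuous_map_iff_continuous)
    thus ?thesis
      by (auto simp: continuous_map_in_subtopology entire_mult entire_const)
  qed
  fix U assume U: "openin ?P U \<and> (\<lambda>x. 0) \<in> U"
  then obtain W where W: "open W" "U = W \<inter> ?H" by (auto simp: openin_open)
  hence "openin (product_topology (\<lambda>_. euclidean) UNIV) W" "(\<lambda>x. 0) \<in> W"
    using U by (simp_all add: open_fun_def)
  from product_topology_open_contains_basis[OF this]
  obtain X where X: "(\<lambda>_. 0) \<in> Pi\<^sub>E UNIV X" "\<And>i. open (X i)" "finite {i. X i \<noteq> UNIV}"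
      "Pi\<^sub>E UNIV X \<subseteq> W"
    by auto
  have "\<exists>e>0. ball 0 e \<subseteq> X i" for i
    using X(1,2) openE[of "X i" 0] by (metis PiE_iff UNIV_I)
  then obtain e where e: "\<And>i. e i > 0" "\<And>i. ball 0 (e i) \<subseteq> X i" by metis
  define C where "C = Pi\<^sub>E UNIV (\<lambda>i. if X i = UNIV then UNIV else ball 0 (e i)) \<inter> ?H"
  have "open (Pi\<^sub>E UNIV (\<lambda>i. if X i = UNIV then UNIV else ball 0 (e i)))"
    using X(3) by (intro open_PiE) (auto elim: rev_finite_subset)
  hence "openin ?P C" unfolding C_def by (subst Int_commute) (rule openin_open_Int)
  moreover have "(\<lambda>x. 0) \<in> C" using e(1) by (auto simp: C_def entire_const)
  moreover have "C \<subseteq> U"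
  proof -
    have "(if X i = UNIV then UNIV else ball 0 (e i)) \<subseteq> X i" for i
      using e(2) by auto
    hence "Pi\<^sub>E UNIV (\<lambda>i. if X i = UNIV then UNIV else ball 0 (e i)) \<subseteq> Pi\<^sub>E UNIV X"
      by (intro PiE_mono)
    thus ?thesis using X(4) W(2) by (auto simp: C_def)
  qed
  moreover have "convex_funset C"
    unfolding convex_funset_def
  proof (intro ballI allI impI)
    fix f g t assume fg: "f \<in> C" "g \<in> C" and t: "0 \<le> t \<and> t \<le> (1::real)"
    have "complex_of_real (1 - t) * f i + complex_of_real t * g i \<in> ball 0 (e i)"
      if "X i \<noteq> UNIV" for i
    proof -
      have "f i \<in> ball 0 (e i)" "g i \<in> ball 0 (e i)"
        using fg that by (auto simp: C_def PiE_iff split: if_splits)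
      from convexD[OF convex_ball this, of "1 - t" t] t show ?thesis
        by (simp add: scaleR_conv_of_real)
    qed
    moreover have "(\<lambda>x. complex_of_real (1 - t) * f x + complex_of_real t * g x) \<in> ?H"
      using fg by (auto simp: C_def intro!: entire_add entire_mult entire_const)
    ultimately show "(\<lambda>x. complex_of_real (1 - t) * f x + complex_of_real t * g x) \<in> C"
      by (auto simp: C_def PiE_iff)
  qed
  ultimately show "\<exists>C. openin ?P C \<and> (\<lambda>x. 0) \<in> C \<and> convex_funset C \<and> C \<subseteq> U"
    by blast
qed

lemma continuous_map_pullback_pointwise:
  "continuous_map (compact_open (cspace n)) (top_of_set (entire UNIV)) (\<lambda>g. g \<circ> proj n)"
proof -
  have "continuous_map (compact_open (cspace n)) (product_topology (\<lambda>_. euclidean) UNIV)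
          (\<lambda>g. g \<circ> proj n)"
    by (rule continuous_map_coordinatewise_then_product)
      (auto simp: proj_in_cspace continuous_map_eval_compact_open)
  thus ?thesis
    by (auto simp: euclidean_product_topology continuous_map_in_subtopology topspace_compact_open
        entire_pullback)
qed

lemma continuous_map_pullback_tau_0: 
  "continuous_map (compact_open (cspace n)) tau_0 (\<lambda>g. g \<circ> proj n)"
  unfolding tau_0_def compact_open_def[of UNIV]
proof (rule continuous_on_generated_topo)
  fix S assume "S \<in> {{f \<in> entire UNIV. f ` K \<subseteq> U} | K U. compact K \<and> K \<subseteq> UNIV \<and> open U}"
  then obtain K U where S: "S = {f \<in> entire UNIV. f ` K \<subseteq> U}" "compact K" "open U" by blast
  have "(\<lambda>g. g \<circ> proj n) -` S \<inter> topspace (compact_open (cspace n))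
      = {g \<in> entire (cspace n). g ` (proj n ` K) \<subseteq> U}"
    using entire_pullback[of _ n] by (auto simp: S topspace_compact_open image_subset_iff)
  moreover have "compact (proj n ` K)" "proj n ` K \<subseteq> cspace n"
    using S(2) continuous_on_proj by (auto intro: compact_continuous_image proj_in_cspace)
  ultimately show "openin (compact_open (cspace n))
      ((\<lambda>g. g \<circ> proj n) -` S \<inter> topspace (compact_open (cspace n)))"
    unfolding compact_open_def using S(3)
    by (auto intro!: topology_generated_by_Basis)
next
  have eq: "\<Union> {{f \<in> entire UNIV. f ` K \<subseteq> U} | K U. compact K \<and> K \<subseteq> UNIV \<and> open U} = entire UNIV"
    using topspace_compact_open[of UNIV] unfolding compact_open_def topology_generated_by_topspace .
  show "(\<lambda>g. g \<circ> proj n) ` topspace (compact_open (cspace n))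
      \<subseteq> \<Union> {{f \<in> entire UNIV. f ` K \<subseteq> U} | K U. compact K \<and> K \<subseteq> UNIV \<and> open U}"
    unfolding eq topspace_compact_open by (intro image_subsetI entire_pullback)
qed

text \<open>
  For \<^const>\<open>tau_delta\<close>, the pullbacks are continuous because they are so into every topology of
  the supremum, and the evaluations are continuous because the topology of pointwise convergence
  is one of these.
\<close>

lemma topology_facts:
  assumes "T = tau_0 \<or> T = tau_delta"
  shows topspace_tau: "topspace T = entire UNIV"
    and continuous_map_pullback_tau: "n \<ge> 1 \<Longrightarrow> continuous_map (compact_open (cspace n)) T (\<lambda>g. g \<circ> proj n)"
    and continuous_map_eval_tau: "continuous_map T euclidean (\<lambda>f. f x)"
proof -
  let ?P = "top_of_set (entire UNIV)"
  define \<T> where "\<T> = {T. locally_convex_topology (entire UNIV) T \<and>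
         (\<forall>n\<ge>1. continuous_map (compact_open (cspace n)) T (\<lambda>g. g \<circ> proj n))}"
  have td: "tau_delta = topology_generated_by {U. \<exists>T\<in>\<T>. openin T U}"
    by (simp add: tau_delta_def \<T>_def conj_assoc Bex_def)
  have P: "?P \<in> \<T>"
    by (simp add: \<T>_def locally_convex_pointwise continuous_map_pullback_pointwise)
  have top: "topspace T' = entire UNIV" if "T' \<in> \<T>" for T'
    using that by (simp add: \<T>_def locally_convex_topology_def)
  have topd: "topspace tau_delta = entire UNIV"
    unfolding td topology_generated_by_topspace
  proof
    show "\<Union> {U. \<exists>T\<in>\<T>. openin T U} \<subseteq> entire UNIV"
      using top openin_subset by blast
    show "entire UNIV \<subseteq> \<Union> {U. \<exists>T\<in>\<T>. openin T U}"
      using P by (intro Union_upper) (metis (mono_tags, lifting) mem_Collect_eq openin_topspace top)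
  qed
  show "topspace T = entire UNIV"
    using assms
  proof
    assume "T = tau_0"
    thus ?thesis by (simp only: tau_0_def topspace_compact_open)
  next
    assume "T = tau_delta"
    thus ?thesis by (simp only: topd)
  qed
  have "continuous_map (compact_open (cspace n)) tau_delta (\<lambda>g. g \<circ> proj n)" if "n \<ge> 1" for n
    unfolding td
  proof (rule continuous_on_generated_topo)
    fix U assume "U \<in> {U. \<exists>T\<in>\<T>. openin T U}"
    then obtain T' where "T' \<in> \<T>" "openin T' U" by blast
    moreover from this that have "continuous_map (compact_open (cspace n)) T' (\<lambda>g. g \<circ> proj n)"
      by (simp add: \<T>_def)
    ultimately show
      "openin (compact_open (cspace n)) ((\<lambda>g. g \<circ> proj n) -` U \<inter> topspace (compact_open (cspace n)))"
      unfolding continuous_map_alt by blast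
  next
    show "(\<lambda>g. g \<circ> proj n) ` topspace (compact_open (cspace n)) \<subseteq> \<Union> {U. \<exists>T\<in>\<T>. openin T U}"
      unfolding topd[unfolded td topology_generated_by_topspace] topspace_compact_open
      by (intro image_subsetI entire_pullback)
  qed
  thus "continuous_map (compact_open (cspace n)) T (\<lambda>g. g \<circ> proj n)" if "n \<ge> 1"
    using assms that continuous_map_pullback_tau_0 by metis
  have "continuous_map tau_delta euclidean (\<lambda>f. f x)"
    unfolding continuous_map_def topd
  proof (intro conjI allI impI)
    fix U :: "complex set" assume "openin euclidean U"
    hence "open ((\<lambda>f. f x) -` U :: ((nat \<Rightarrow> complex) \<Rightarrow> complex) set)"
      by (intro open_vimage continuous_on_coord) simp
    hence "openin ?P {f \<in> entire UNIV. f x \<in> U}"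
      by (auto simp: openin_open intro!: exI[of _ "(\<lambda>f. f x) -` U"])
    thus "openin tau_delta {f \<in> entire UNIV. f x \<in> U}"
      unfolding td using P by (intro topology_generated_by_Basis) blast
  qed auto
  moreover have "continuous_map tau_0 euclidean (\<lambda>f. f x)"
    unfolding tau_0_def by (rule continuous_map_eval_compact_open) simp
  ultimately show "continuous_map T euclidean (\<lambda>f. f x)"
    using assms by metis
qed

section \<open>Polydiscs\<close>

definition polydisc :: "nat \<Rightarrow> real \<Rightarrow> (nat \<Rightarrow> complex) set" where
  "polydisc n R = {x \<in> cspace n. \<forall>i. norm (x i) \<le> R}"

lemma compact_polydisc: "compact (polydisc n R)"
proof (cases "R \<ge> 0")
  case True
  define X where "X i = (if i < n then cball 0 R else {0::complex})" for i
  have "polydisc n R = Pi\<^sub>E UNIV X"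
    using True by (auto simp: polydisc_def X_def cspace_def PiE_iff split: if_splits) (metis norm_zero)
  moreover have "compactin (product_topology (\<lambda>i. euclidean) UNIV) (Pi\<^sub>E UNIV X)"
    by (simp add: compactin_PiE X_def)
  ultimately show ?thesis by (simp add: euclidean_product_topology)
next
  case False
  hence "polydisc n R = {}" by (auto simp: polydisc_def) (meson norm_ge_zero order_trans)
  thus ?thesis by simp
qed

lemma polydisc_bound:
  assumes "f \<in> entire UNIV"
  obtains B where "B > 0" "\<And>x. x \<in> polydisc n R \<Longrightarrow> norm (f x) \<le> B"
proof -
  have "continuous_on (polydisc n R) f"
    using assms by (meson continuous_on_subset entire_UNIV_iff top_greatest)
  hence "bounded (f ` polydisc n R)"
    by (intro compact_imp_bounded compact_continuous_image compact_polydisc)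
  thus ?thesis using that by (auto simp: bounded_pos)
qed

lemma compact_subset_polydisc:
  assumes "compact K" "K \<subseteq> cspace n"
  obtains R where "R \<ge> 0" "K \<subseteq> polydisc n R"
proof -
  have "\<exists>b>0. \<forall>x\<in>K. norm (x i) \<le> b" for i
  proof -
    have "bounded ((\<lambda>x. x i) ` K)"
      using assms(1) by (intro compact_imp_bounded compact_continuous_image continuous_on_coord)
    thus ?thesis by (auto simp: bounded_pos)
  qed
  then obtain b where b: "\<And>i. b i > 0" "\<And>i x. x \<in> K \<Longrightarrow> norm (x i) \<le> b i" by metis
  have le: "norm (x i) \<le> (\<Sum>i<n. b i)" if "x \<in> K" for x i
  proof (cases "i < n")
    case True
    have "norm (x i) \<le> b i" using b that by blast
    also have "\<dots> \<le> (\<Sum>i<n. b i)"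
      using True b(1) by (intro member_le_sum) (auto intro: less_imp_le)
    finally show ?thesis .
  next
    case False
    hence "x i = 0" using assms(2) that by (auto simp: cspace_def)
    thus ?thesis using b(1) by (simp add: sum_nonneg less_imp_le)
  qed
  show ?thesis
  proof (rule that)
    show "0 \<le> (\<Sum>i<n. b i)" using b(1) by (simp add: sum_nonneg less_imp_le)
    show "K \<subseteq> polydisc n (\<Sum>i<n. b i)" using assms(2) le by (auto simp: polydisc_def)
  qed
qed

section \<open>Interpolation at roots of unity\<close>

text \<open>
  A function of \<open>k + 1\<close> variables has to be approximated by sums of products of functions of the
  first \<open>k\<close> variables with polynomials in the last one. Taylor coefficients would do, but then
  their dependence on the other variables has to be shown to be entire. Polynomial interpolation
  only uses values of the function at fixed points, where this dependence is evident.
\<close>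

lemma sum_unity_powers:
  fixes N l j :: nat
  defines "\<omega> \<equiv> cis (2 * pi / N)"
  assumes "l < N" "j < N"
  shows "(\<Sum>m<N. (\<omega> ^ m) ^ l / (\<omega> ^ m) ^ j) = (if l = j then of_nat N else 0)"
proof -
  have \<omega>0: "\<omega> \<noteq> 0" by (simp add: \<omega>_def)
  have N: "N > 0" using assms by simp
  define q where "q = \<omega> ^ l / \<omega> ^ j"
  have "(\<omega> ^ m) ^ l / (\<omega> ^ m) ^ j = q ^ m" for m
    by (simp add: q_def power_divide mult.commute flip: power_mult)
  hence sum: "(\<Sum>m<N. (\<omega> ^ m) ^ l / (\<omega> ^ m) ^ j) = (\<Sum>m<N. q ^ m)" by simp
  show ?thesis
  proof (cases "l = j")
    case True
    hence "q = 1" using \<omega>0 by (simp add: q_def)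
    thus ?thesis using sum True by simp
  next
    case False
    have "\<omega> ^ N = cis (real N * (2 * pi / real N))" unfolding \<omega>_def by (rule Complex.DeMoivre)
    hence "\<omega> ^ N = 1" using N by simp
    hence "(\<omega> ^ l) ^ N = 1" "(\<omega> ^ j) ^ N = 1"
      by (metis power_mult mult.commute power_one)+
    hence qN: "q ^ N = 1" by (simp add: q_def power_divide)
    have "inj_on (\<lambda>k. cis (2 * pi * real k / real N)) {..<N}"
      using Complex.bij_betw_roots_unity[OF N] by (auto simp: bij_betw_def)
    moreover have "\<omega> ^ k = cis (2 * pi * real k / real N)" for k
      by (simp add: \<omega>_def Complex.DeMoivre mult_ac)
    ultimately have "\<omega> ^ l \<noteq> \<omega> ^ j" using assms False by (auto simp: inj_on_def)
    hence "q \<noteq> 1" using \<omega>0 by (simp add: q_def)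
    thus ?thesis using sum False geometric_sum[of q N] qN by simp
  qed
qed

text \<open>
  The polynomial of degree less than \<open>N\<close> that agrees with \<open>g\<close> at the \<open>N\<close>-th roots of unity scaled
  by \<open>R\<close>, written as a discrete Cauchy integral truncated after \<open>N\<close> terms of the geometric series.
\<close>

definition interpolate :: "real \<Rightarrow> nat \<Rightarrow> (complex \<Rightarrow> complex) \<Rightarrow> complex \<Rightarrow> complex" where
  "interpolate R N g t =
     (\<Sum>m<N. \<Sum>j<N. g (of_real R * cis (2 * pi / N) ^ m) / of_nat N
        * (t / (of_real R * cis (2 * pi / N) ^ m)) ^ j)"

lemma interpolate_power:
  assumes "R > 0" "l < N"
  shows "interpolate R N (\<lambda>w. w ^ l) t = t ^ l"
proof -
  define \<omega> where "\<omega> = cis (2 * pi / N)"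
  have "interpolate R N (\<lambda>w. w ^ l) t =
      (\<Sum>j<N. \<Sum>m<N. (of_real R * \<omega> ^ m) ^ l / of_nat N * (t / (of_real R * \<omega> ^ m)) ^ j)"
    unfolding interpolate_def \<omega>_def by (rule sum.swap)
  also have "\<dots> = (\<Sum>j<N. of_real R ^ l * t ^ j / (of_nat N * of_real R ^ j)
                     * (\<Sum>m<N. (\<omega> ^ m) ^ l / (\<omega> ^ m) ^ j))"
    unfolding sum_distrib_left
    by (intro sum.cong refl) (simp add: power_mult_distrib power_divide mult_ac)
  also have "\<dots> = (\<Sum>j<N. if l = j then t ^ l else 0)"
    using assms by (intro sum.cong) (auto simp: \<omega>_def sum_unity_powers)
  also have "\<dots> = t ^ l" using assms by simp
  finally show ?thesis .
qed

lemma norm_interpolate_power_le: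
  assumes "R > 0" "norm t \<le> R"
  shows "norm (interpolate R N (\<lambda>w. w ^ l) t) \<le> N * R ^ l"
proof -
  have "norm (interpolate R N (\<lambda>w. w ^ l) t) \<le>
      (\<Sum>m<N. \<Sum>j<N. norm ((of_real R * cis (2 * pi / N) ^ m) ^ l / of_nat N
        * (t / (of_real R * cis (2 * pi / N) ^ m)) ^ j))"
    unfolding interpolate_def by (rule order_trans[OF norm_sum]) (intro sum_mono norm_sum)
  also have "\<dots> \<le> (\<Sum>m<N. \<Sum>j<N. R ^ l / N)"
  proof (intro sum_mono)
    fix m j
    have "norm t / R \<le> 1" using assms by simp
    hence "(norm t / R) ^ j \<le> 1" using assms by (intro power_le_one) auto
    hence "R ^ l / N * (norm t / R) ^ j \<le> R ^ l / N * 1"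
      using assms by (intro mult_left_mono) auto
    thus "norm ((of_real R * cis (2 * pi / N) ^ m) ^ l / of_nat N
        * (t / (of_real R * cis (2 * pi / N) ^ m)) ^ j) \<le> R ^ l / N"
      using assms by (simp add: norm_mult norm_divide norm_power)
  qed
  also have "\<dots> \<le> N * R ^ l" by simp
  finally show ?thesis .
qed

text \<open>
  Interpolation is exact on the powers below \<open>N\<close>, so only the tail of the Taylor series of \<open>g\<close>
  contributes. Its coefficients are controlled by Cauchy's inequality on the disc of twice the
  radius, and the crude factor \<open>N\<close> from the triangle inequality is absorbed by \<open>(1 / 2) ^ N\<close>.
\<close>

lemma norm_interpolation_error_le:
  assumes g: "g holomorphic_on UNIV" and R: "R > 0"
    and M: "\<And>w. norm w \<le> 2 * R \<Longrightarrow> norm (g w) \<le> M"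
    and t: "norm t \<le> R" and N: "N > 0"
  shows "norm (g t - interpolate R N g t) \<le> M * (2 * (1 + real N) * (1 / 2) ^ N)"
proof -
  define c where "c l = (deriv ^^ l) g 0 / fact l" for l
  have M0: "M \<ge> 0" using M[of 0] R by (smt (verit) norm_ge_zero norm_zero)
  have g_sums: "(\<lambda>l. c l * w ^ l) sums g w" for w
    using holomorphic_power_series[of g 0 "norm w + 1" w] holomorphic_on_subset[OF g subset_UNIV]
    by (simp add: c_def)
  have c_le: "norm (c l) \<le> M / (2 * R) ^ l" for l
  proof -
    have "norm ((deriv ^^ l) g 0) \<le> fact l * M / (2 * R) ^ l"
      using g R M
      by (intro Cauchy_inequality)
        (auto intro: holomorphic_on_subset continuous_on_subset holomorphic_on_imp_continuous_on)
    thus ?thesis by (simp add: c_def norm_divide field_simps)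
  qed
  define d where "d l = t ^ l - interpolate R N (\<lambda>w. w ^ l) t" for l
  have "(\<lambda>l. c l * interpolate R N (\<lambda>w. w ^ l) t) sums interpolate R N g t"
  proof -
    have "(\<lambda>l. \<Sum>m<N. \<Sum>j<N. c l * (of_real R * cis (2 * pi / N) ^ m) ^ l / of_nat N
        * (t / (of_real R * cis (2 * pi / N) ^ m)) ^ j) sums interpolate R N g t"
      unfolding interpolate_def by (intro sums_sum sums_mult2 sums_divide g_sums)
    thus ?thesis by (simp add: interpolate_def sum_distrib_left mult.assoc)
  qed
  hence d_sums: "(\<lambda>l. c l * d l) sums (g t - interpolate R N g t)"
    using sums_diff[OF g_sums[of t]] by (simp add: d_def right_diff_distrib)
  have d0: "d l = 0" if "l < N" for l
    using that R by (simp add: d_def interpolate_power)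
  have cd: "norm (c l * d l) \<le> M * (1 + real N) * (1 / 2) ^ l" for l
  proof -
    have "norm (d l) \<le> norm t ^ l + N * R ^ l"
      unfolding d_def using norm_triangle_ineq4 norm_interpolate_power_le[OF R t, of N l]
      by (smt (verit) norm_power)
    also have "\<dots> \<le> R ^ l + N * R ^ l" using t by (simp add: power_mono)
    finally have "norm (d l) \<le> (1 + N) * R ^ l" by (simp add: algebra_simps)
    hence "norm (c l * d l) \<le> M / (2 * R) ^ l * ((1 + N) * R ^ l)"
      unfolding norm_mult using c_le[of l] M0 R by (intro mult_mono) auto
    also have "\<dots> = M * (1 + real N) * (1 / 2) ^ l"
      using R by (simp add: power_mult_distrib power_divide field_simps)
    finally show ?thesis .
  qed
  have 1: "(\<lambda>l. c (l + N) * d (l + N)) sums (g t - interpolate R N g t)"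
    using sums_iff_shift[of "\<lambda>l. c l * d l" N] d_sums d0 by simp
  have 2: "(\<lambda>l. M * (1 + real N) * (1 / 2) ^ N * (1 / 2) ^ l) sums
      (M * (1 + real N) * (1 / 2) ^ N * 2)"
    using sums_mult[OF geometric_sums[of "1 / 2 :: real"]] by simp
  have "norm (c (l + N) * d (l + N)) \<le> M * (1 + real N) * (1 / 2) ^ N * (1 / 2) ^ l" for l
    using cd[of "l + N"] by (simp add: power_add mult_ac)
  from norm_suminf_le[OF this sums_summable[OF 2]]
  show ?thesis unfolding sums_unique[OF 1, symmetric] sums_unique[OF 2, symmetric]
    by (simp add: algebra_simps)
qed

section \<open>Bounded functionals on functions of finitely many coordinates\<close>

locale cylinder_functional =
  fixes n :: nat and \<Lambda> :: "((nat \<Rightarrow> complex) \<Rightarrow> complex) \<Rightarrow> complex" and C R :: real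
  assumes add: "\<lbrakk>f \<in> cylinder n; g \<in> cylinder n\<rbrakk> \<Longrightarrow> \<Lambda> (\<lambda>x. f x + g x) = \<Lambda> f + \<Lambda> g"
    and scale: "f \<in> cylinder n \<Longrightarrow> \<Lambda> (\<lambda>x. c * f x) = c * \<Lambda> f"
    and bound: "\<lbrakk>f \<in> cylinder n; 0 < M; \<And>x. x \<in> polydisc n R \<Longrightarrow> norm (f x) \<le> M\<rbrakk>
                \<Longrightarrow> norm (\<Lambda> f) \<le> C * M"
    and C_ge_1: "1 \<le> C"
begin

lemma diff: "\<lbrakk>f \<in> cylinder n; g \<in> cylinder n\<rbrakk> \<Longrightarrow> \<Lambda> (\<lambda>x. f x - g x) = \<Lambda> f - \<Lambda> g"
  using add[of f "\<lambda>x. (-1) * g x"] scale[of g "-1"] cylinder_mult[OF cylinder_const, of g n "-1"]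
  by simp

lemma sum:
  assumes "\<And>i. i \<in> I \<Longrightarrow> f i \<in> cylinder n"
  shows "\<Lambda> (\<lambda>x. \<Sum>i\<in>I. f i x) = (\<Sum>i\<in>I. \<Lambda> (f i))"
proof -
  have 0: "\<Lambda> (\<lambda>x. 0) = 0" using scale[OF cylinder_const, of 0 0] by simp
  show ?thesis using assms
    by (induction I rule: infinite_finite_induct)
      (auto simp: 0 add cylinder_sum)
qed

text \<open>
  Differentiation under \<open>\<Lambda>\<close>: the quadratic error of the exponential is uniform on the polydisc
  that controls \<open>\<Lambda>\<close>.
\<close>

lemma has_field_derivative_exp:
  assumes q: "q \<in> cylinder n" and \<phi>: "\<phi> \<in> cylinder n"
  shows "((\<lambda>z. \<Lambda> (\<lambda>x. q x * exp (z * \<phi> x))) has_field_derivative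
           \<Lambda> (\<lambda>x. q x * \<phi> x * exp (z * \<phi> x))) (at z)"
proof -
  define F where "F z = \<Lambda> (\<lambda>x. q x * exp (z * \<phi> x))" for z
  define F' where "F' = \<Lambda> (\<lambda>x. q x * \<phi> x * exp (z * \<phi> x))"
  have cyl: "(\<lambda>x. q x * exp (w * \<phi> x)) \<in> cylinder n" "(\<lambda>x. q x * \<phi> x * exp (w * \<phi> x)) \<in> cylinder n" for w
    by (intro cylinder_mult cylinder_exp q \<phi> cylinder_const)+
  obtain Q where Q: "Q > 0" "\<And>x. x \<in> polydisc n R \<Longrightarrow> norm (q x) \<le> Q"
    using polydisc_bound[OF cylinder_entire[OF q]] by blast
  obtain B where B: "B > 0" "\<And>x. x \<in> polydisc n R \<Longrightarrow> norm (\<phi> x) \<le> B"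
    using polydisc_bound[OF cylinder_entire[OF \<phi>]] by blast
  define D where "D = C * (Q * exp (norm z * B) * (exp B * B\<^sup>2))"
  have est: "norm ((F (z + h) - F z) / h - F') \<le> D * norm h" if h: "h \<noteq> 0" "norm h \<le> 1" for h
  proof -
    have eq: "F (z + h) - F z - h * F' =
        \<Lambda> (\<lambda>x. q x * exp (z * \<phi> x) * (exp (h * \<phi> x) - 1 - h * \<phi> x))"
    proof -
      have "F (z + h) - F z = \<Lambda> (\<lambda>x. q x * exp ((z + h) * \<phi> x) - q x * exp (z * \<phi> x))"
        unfolding F_def by (rule diff[symmetric, OF cyl(1) cyl(1)])
      moreover have "h * F' = \<Lambda> (\<lambda>x. h * (q x * \<phi> x * exp (z * \<phi> x)))"
        unfolding F'_def by (rule scale[symmetric, OF cyl(2)])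
      ultimately have "F (z + h) - F z - h * F' =
          \<Lambda> (\<lambda>x. (q x * exp ((z + h) * \<phi> x) - q x * exp (z * \<phi> x)) - h * (q x * \<phi> x * exp (z * \<phi> x)))"
        using diff[OF cylinder_diff[OF cyl(1) cyl(1)] cylinder_mult[OF cylinder_const cyl(2)]] by simp
      also have "(\<lambda>x. (q x * exp ((z + h) * \<phi> x) - q x * exp (z * \<phi> x)) - h * (q x * \<phi> x * exp (z * \<phi> x)))
          = (\<lambda>x. q x * exp (z * \<phi> x) * (exp (h * \<phi> x) - 1 - h * \<phi> x))"
        by (simp add: fun_eq_iff algebra_simps exp_add)
      finally show ?thesis .
    qed
    have "norm (\<Lambda> (\<lambda>x. q x * exp (z * \<phi> x) * (exp (h * \<phi> x) - 1 - h * \<phi> x)))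
        \<le> C * (Q * exp (norm z * B) * (exp B * (norm h * B)\<^sup>2))"
    proof (rule bound)
      show "(\<lambda>x. q x * exp (z * \<phi> x) * (exp (h * \<phi> x) - 1 - h * \<phi> x)) \<in> cylinder n"
        by (intro cylinder_mult cylinder_diff cylinder_exp q \<phi> cylinder_const)
      show "0 < Q * exp (norm z * B) * (exp B * (norm h * B)\<^sup>2)"
        using Q B h by simp
      fix x assume x: "x \<in> polydisc n R"
      have hB: "norm (h * \<phi> x) \<le> norm h * B"
        using B(2)[OF x] by (simp add: norm_mult mult_left_mono)
      also have "\<dots> \<le> 1 * B" using h B by (intro mult_right_mono) auto
      finally have hB': "norm (h * \<phi> x) \<le> B" by simp
      have "norm (exp (h * \<phi> x) - 1 - h * \<phi> x) \<le> exp (norm (h * \<phi> x)) * norm (h * \<phi> x) ^ 2"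
        by (rule exp_linear_error)
      also have "\<dots> \<le> exp B * (norm h * B)\<^sup>2"
        using hB hB' by (intro mult_mono power_mono) auto
      finally have 1: "norm (exp (h * \<phi> x) - 1 - h * \<phi> x) \<le> exp B * (norm h * B)\<^sup>2" .
      have "norm (exp (z * \<phi> x)) \<le> exp (norm (z * \<phi> x))" by (rule norm_exp)
      also have "\<dots> \<le> exp (norm z * B)"
        using B(2)[OF x] by (simp add: norm_mult mult_left_mono)
      finally show "norm (q x * exp (z * \<phi> x) * (exp (h * \<phi> x) - 1 - h * \<phi> x))
          \<le> Q * exp (norm z * B) * (exp B * (norm h * B)\<^sup>2)"
        unfolding norm_mult using 1 Q(2)[OF x] Q(1) by (intro mult_mono) auto
    qed
    also have "\<dots> = D * norm h * norm h" by (simp add: D_def power2_eq_square mult_ac)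
    finally have "norm (F (z + h) - F z - h * F') \<le> D * norm h * norm h" by (simp add: eq)
    moreover have "(F (z + h) - F z) / h - F' = (F (z + h) - F z - h * F') / h"
      using h by (simp add: field_simps)
    ultimately show ?thesis using h by (simp add: norm_divide divide_le_eq)
  qed
  have "((\<lambda>h. (F (z + h) - F z) / h - F') \<longlongrightarrow> 0) (at 0)"
  proof (rule Lim_null_comparison)
    show "\<forall>\<^sub>F h in at 0. norm ((F (z + h) - F z) / h - F') \<le> D * norm h"
      using est by (auto simp: eventually_at intro!: exI[of _ 1])
    show "((\<lambda>h. D * norm h) \<longlongrightarrow> 0) (at (0::complex))"
      by (intro tendsto_mult_right_zero tendsto_norm_zero tendsto_ident_at)
  qed
  hence "(F has_field_derivative F') (at z)"
    unfolding DERIV_def by (rule LIM_zero_cancel)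
  thus ?thesis by (simp add: F_def[abs_def] F'_def)
qed

definition exp_linear :: "(nat \<Rightarrow> complex) \<Rightarrow> (nat \<Rightarrow> complex) \<Rightarrow> complex" where
  "exp_linear a x = exp (\<Sum>i<n. a i * x i)"

text \<open>
  Requiring the vanishing for all exponents \<open>a\<close> at once makes the condition stable under
  multiplication by coordinates, because \<open>x i * exp_linear a x\<close> is the derivative of
  \<open>exp_linear a x\<close> in \<open>a i\<close>.
\<close>

definition null_multiplier :: "((nat \<Rightarrow> complex) \<Rightarrow> complex) \<Rightarrow> bool" where
  "null_multiplier q \<longleftrightarrow> q \<in> cylinder n \<and> (\<forall>a. \<Lambda> (\<lambda>x. q x * exp_linear a x) = 0)"

lemma exp_linear_cylinder: "exp_linear a \<in> cylinder n"
  unfolding exp_linear_def[abs_def]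
  by (intro cylinder_exp cylinder_sum cylinder_mult cylinder_const cylinder_coord) auto

lemma null_multiplier_cylinder: "null_multiplier q \<Longrightarrow> q \<in> cylinder n"
  by (simp add: null_multiplier_def)

lemma null_multiplier_coord:
  assumes q: "null_multiplier q" and i: "i < n"
  shows "null_multiplier (\<lambda>x. x i * q x)"
  unfolding null_multiplier_def
proof (intro conjI allI)
  show "(\<lambda>x. x i * q x) \<in> cylinder n"
    using q i by (intro cylinder_mult cylinder_coord null_multiplier_cylinder)
  fix a :: "nat \<Rightarrow> complex"
  define q' where "q' = (\<lambda>x. q x * exp_linear (a(i := 0)) x)"
  have q': "q' \<in> cylinder n"
    unfolding q'_def using q by (intro cylinder_mult exp_linear_cylinder null_multiplier_cylinder)
  have split: "exp_linear (a(i := z)) x = exp_linear (a(i := 0)) x * exp (z * x i)" for z x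
  proof -
    have "(\<Sum>k<n. (a(i := z)) k * x k) = (\<Sum>k<n. (a(i := 0)) k * x k + (if k = i then z * x i else 0))"
      by (rule sum.cong) auto
    also have "\<dots> = (\<Sum>k<n. (a(i := 0)) k * x k) + z * x i"
      using i by (simp add: sum.distrib)
    finally show ?thesis by (simp add: exp_linear_def exp_add)
  qed
  have "\<Lambda> (\<lambda>x. q' x * exp (z * x i)) = 0" for z
    using q split[of z] by (simp add: null_multiplier_def q'_def mult.assoc flip: split)
  hence "((\<lambda>z. 0) has_field_derivative \<Lambda> (\<lambda>x. q' x * x i * exp (a i * x i))) (at (a i))"
    using has_field_derivative_exp[OF q' cylinder_coord[OF i], of "a i"] by simp
  hence "\<Lambda> (\<lambda>x. q' x * x i * exp (a i * x i)) = 0"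
    using DERIV_unique DERIV_const by blast
  moreover have "q' x * x i * exp (a i * x i) = x i * q x * exp_linear a x" for x
    using split[of "a i" x] by (simp add: q'_def)
  ultimately show "\<Lambda> (\<lambda>x. x i * q x * exp_linear a x) = 0" by simp
qed

lemma null_multiplier_coord_power:
  "null_multiplier q \<Longrightarrow> i < n \<Longrightarrow> null_multiplier (\<lambda>x. x i ^ j * q x)"
  by (induction j) (auto dest: null_multiplier_coord simp: mult.assoc)

lemma null_multiplier_scale: "null_multiplier q \<Longrightarrow> null_multiplier (\<lambda>x. c * q x)"
  by (auto simp: null_multiplier_def mult.assoc
      intro!: cylinder_mult cylinder_const trans[OF scale] exp_linear_cylinder)

lemma null_multiplier_sum:
  assumes "\<And>i. i \<in> I \<Longrightarrow> null_multiplier (f i)"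
  shows "null_multiplier (\<lambda>x. \<Sum>i\<in>I. f i x)"
  using assms by (auto simp: null_multiplier_def sum_distrib_right
      intro!: cylinder_sum trans[OF sum] cylinder_mult exp_linear_cylinder)

lemma null_multiplier_closed:
  assumes f: "f \<in> cylinder n"
    and approx: "\<And>\<epsilon>. \<epsilon> > 0 \<Longrightarrow>
      \<exists>q. null_multiplier q \<and> (\<forall>x\<in>polydisc n R. norm (f x - q x) \<le> \<epsilon>)"
  shows "null_multiplier f"
  unfolding null_multiplier_def
proof (intro conjI allI f)
  fix a
  obtain B where B: "B > 0" "\<And>x. x \<in> polydisc n R \<Longrightarrow> norm (exp_linear a x) \<le> B"
    using polydisc_bound[OF cylinder_entire[OF exp_linear_cylinder]] by blast
  have "norm (\<Lambda> (\<lambda>x. f x * exp_linear a x)) \<le> \<epsilon>" if "\<epsilon> > 0" for \<epsilon>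
  proof -
    have CB: "C * B > 0" using C_ge_1 B(1) by simp
    hence "\<epsilon> / (C * B) > 0" using that by simp
    then obtain q where q: "null_multiplier q"
        "\<And>x. x \<in> polydisc n R \<Longrightarrow> norm (f x - q x) \<le> \<epsilon> / (C * B)"
      using approx by blast
    have "\<Lambda> (\<lambda>x. f x * exp_linear a x) = \<Lambda> (\<lambda>x. f x * exp_linear a x) - \<Lambda> (\<lambda>x. q x * exp_linear a x)"
      using q(1) by (simp add: null_multiplier_def)
    also have "\<dots> = \<Lambda> (\<lambda>x. f x * exp_linear a x - q x * exp_linear a x)"
      using q(1) by (intro diff[symmetric] cylinder_mult f exp_linear_cylinder null_multiplier_cylinder)
    also have "norm \<dots> \<le> C * (\<epsilon> / (C * B) * B)"
    proof (rule bound)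
      show "(\<lambda>x. f x * exp_linear a x - q x * exp_linear a x) \<in> cylinder n"
        using q(1) by (intro cylinder_diff cylinder_mult f exp_linear_cylinder null_multiplier_cylinder)
      show "0 < \<epsilon> / (C * B) * B" using that C_ge_1 B(1) by simp
      fix x assume x: "x \<in> polydisc n R"
      show "norm (f x * exp_linear a x - q x * exp_linear a x) \<le> \<epsilon> / (C * B) * B"
        unfolding left_diff_distrib[symmetric] norm_mult
        using q(2)[OF x] B(2)[OF x] that CB by (intro mult_mono) auto
    qed
    also have "\<dots> = \<epsilon>" using C_ge_1 B(1) by simp
    finally show ?thesis .
  qed
  thus "\<Lambda> (\<lambda>x. f x * exp_linear a x) = 0"
    by (metis field_le_epsilon add_0 norm_le_zero_iff)
qed

text \<open>
  Induction on the number of variables of \<open>f\<close>: interpolation in the last variable approximates \<open>f\<close>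
  by sums of functions of the other variables times powers of the last coordinate. The powers are
  moved to the multiplier \<open>q\<close>, which is why \<open>q\<close> varies in the induction.
\<close>

lemma null_multiplier_mult:
  assumes "k \<le> n" "f \<in> cylinder k" "null_multiplier q"
  shows "null_multiplier (\<lambda>x. f x * q x)"
  using assms
proof (induction k arbitrary: f q)
  case 0
  have "f x = f (\<lambda>_. 0)" for x
    using cylinder_proj[OF 0(2), of x] by (simp add: proj_def)
  hence "(\<lambda>x. f x * q x) = (\<lambda>x. f (\<lambda>_. 0) * q x)" by metis
  thus ?case using null_multiplier_scale[OF 0(3)] by simp
next
  case (Suc k)
  \<comment> \<open>The last variable is frozen at \<open>w\<close>.\<close>
  define f' where "f' w x = f ((proj k x)(k := w))" for w x
  have f': "f' w \<in> cylinder k" for w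
  proof -
    have "(\<lambda>x. f ((proj k x)(k := w))) \<in> entire UNIV"
    proof (rule entire_compose_affine[OF cylinder_entire[OF Suc.prems(2)]])
      show "continuous_on UNIV (\<lambda>x. (proj k x)(k := w))"
      proof (rule continuous_on_coordinatewise_then_product)
        show "continuous_on UNIV (\<lambda>x. ((proj k x)(k := w)) i)" for i
          using continuous_on_product_then_coordinatewise[OF continuous_on_proj[of UNIV k], of i]
          by (cases "i = k") auto
      qed
      show "\<exists>a' b'. \<forall>z. (proj k (\<lambda>i. a i + z * b i))(k := w) = (\<lambda>i. a' i + z * b' i)" for a b
        by (rule exI[of _ "(proj k a)(k := w)"], rule exI[of _ "(proj k b)(k := 0)"])
          (auto simp: proj_line fun_eq_iff)
    qed
    thus ?thesis by (simp add: cylinder_def f'_def[abs_def] proj_proj)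
  qed
  have f'_self: "f' (x k) x = f x" for x
  proof -
    have "(proj k x)(k := x k) = proj (Suc k) x" by (auto simp: proj_def fun_eq_iff)
    thus ?thesis by (simp add: f'_def cylinder_proj[OF Suc.prems(2)])
  qed
  have hol: "(\<lambda>w. f' w x) holomorphic_on UNIV" for x
  proof -
    have "(proj k x)(k := w) = (\<lambda>i. proj k x i + w * (if i = k then 1 else 0))" for w
      by (auto simp: proj_def fun_eq_iff)
    thus ?thesis
      using cylinder_entire[OF Suc.prems(2)] by (simp add: f'_def entire_UNIV_iff)
  qed
  have fq: "(\<lambda>x. f x * q x) \<in> cylinder n"
  proof (rule cylinder_mult)
    show "f \<in> cylinder n" using Suc.prems cylinder_mono[of "Suc k" n] by auto
  qed (rule null_multiplier_cylinder[OF Suc.prems(3)])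
  show ?case
  proof (rule null_multiplier_closed[OF fq])
    fix \<epsilon> :: real assume \<epsilon>: "\<epsilon> > 0"
    define R' where "R' = max R 1"
    obtain M where M: "M > 0" "\<And>x. x \<in> polydisc n (2 * R') \<Longrightarrow> norm (f x) \<le> M"
      using polydisc_bound[OF cylinder_entire[OF Suc.prems(2)]] by blast
    obtain B where B: "B > 0" "\<And>x. x \<in> polydisc n R \<Longrightarrow> norm (q x) \<le> B"
      using polydisc_bound[OF cylinder_entire[OF null_multiplier_cylinder[OF Suc.prems(3)]]] by blast
    have "(\<lambda>N. 2 * B * M * ((1 / 2) ^ N + real N * (1 / 2) ^ N)) \<longlonglongrightarrow> 2 * B * M * (0 + 0)"
      by (intro tendsto_intros LIMSEQ_power_zero powser_times_n_limit_0) auto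
    hence "(\<lambda>N. B * (M * (2 * (1 + real N) * (1 / 2) ^ N))) \<longlonglongrightarrow> 0"
      by (simp add: algebra_simps)
    from order_tendstoD(2)[OF this \<epsilon>] obtain N0
      where "\<And>N. N \<ge> N0 \<Longrightarrow> B * (M * (2 * (1 + real N) * (1 / 2) ^ N)) < \<epsilon>"
      unfolding eventually_sequentially by blast
    then obtain N where N: "N > 0" "B * (M * (2 * (1 + real N) * (1 / 2) ^ N)) < \<epsilon>"
      by (metis max.cobounded1 max.cobounded2 zero_less_Suc Suc_le_eq)
    define w where "w m = of_real R' * cis (2 * pi / N) ^ m" for m
    define p where "p = (\<lambda>x. \<Sum>m<N. \<Sum>j<N. f' (w m) x * ((1 / (of_nat N * w m ^ j)) * (x k ^ j * q x)))"
    have "null_multiplier p"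
      unfolding p_def using Suc.prems
      by (intro null_multiplier_sum Suc.IH f' null_multiplier_scale null_multiplier_coord_power) auto
    moreover have "norm (f x * q x - p x) \<le> \<epsilon>" if x: "x \<in> polydisc n R" for x
    proof -
      have p: "p x = interpolate R' N (\<lambda>w. f' w x) (x k) * q x"
        unfolding p_def interpolate_def sum_distrib_right
        by (intro sum.cong refl) (simp add: w_def power_divide)
      have xk: "norm (x k) \<le> R'" using x by (auto simp: polydisc_def R'_def le_max_iff_disj)
      have "norm (f' v x) \<le> M" if "norm v \<le> 2 * R'" for v
      proof -
        have "(proj k x)(k := v) \<in> polydisc n (2 * R')"
        proof -
          have R': "R' \<ge> 0" "R \<le> R'" by (auto simp: R'_def)
          have "norm (x i) \<le> 2 * R'" for i
            using x R' by (auto simp: polydisc_def) (smt (verit))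
          thus ?thesis
            using x that R' Suc.prems(1) by (auto simp: polydisc_def cspace_def proj_def)
        qed
        thus ?thesis unfolding f'_def by (rule M(2))
      qed
      hence "norm (f' (x k) x - interpolate R' N (\<lambda>w. f' w x) (x k)) \<le> M * (2 * (1 + real N) * (1 / 2) ^ N)"
        using xk N(1) by (intro norm_interpolation_error_le hol) (auto simp: R'_def)
      hence "norm (q x) * norm (f x - interpolate R' N (\<lambda>w. f' w x) (x k))
          \<le> B * (M * (2 * (1 + real N) * (1 / 2) ^ N))"
        using B x by (intro mult_mono) (auto simp: f'_self)
      moreover have "f x * q x - p x = q x * (f x - interpolate R' N (\<lambda>w. f' w x) (x k))"
        by (simp add: p algebra_simps)
      ultimately show ?thesis using N(2) by (simp add: norm_mult)
    qed
    ultimately show "\<exists>h. null_multiplier h \<and> (\<forall>x\<in>polydisc n R. norm (f x * q x - h x) \<le> \<epsilon>)"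
      by blast
  qed
qed

text \<open>
  In other words, the exponentials of linear forms span a dense subspace of the entire functions
  of \<open>n\<close> variables.
\<close>

theorem zero_if_zero_on_exponentials:
  assumes "\<And>a. \<Lambda> (exp_linear a) = 0" "f \<in> cylinder n"
  shows "\<Lambda> f = 0"
proof -
  have "null_multiplier (\<lambda>x. 1)"
    using assms(1) by (simp add: null_multiplier_def cylinder_const)
  hence "null_multiplier (\<lambda>x. f x * 1)" by (intro null_multiplier_mult[OF order_refl] assms)
  hence "\<Lambda> (\<lambda>x. f x * 1 * exp_linear (\<lambda>_. 0) x) = 0" by (simp only: null_multiplier_def)
  thus ?thesis by (simp add: exp_linear_def)
qed

end

section \<open>Convolution operators on functions of finitely many coordinates\<close>

definition restriction :: "nat \<Rightarrow> ((nat \<Rightarrow> complex) \<Rightarrow> complex) \<Rightarrow> (nat \<Rightarrow> complex) \<Rightarrow> complex" where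
  "restriction n f x = (if x \<in> cspace n then f x else 0)"

lemma restriction_entire:
  assumes "f \<in> entire UNIV"
  shows "restriction n f \<in> entire (cspace n)"
  unfolding entire_def
proof (intro CollectI conjI ballI allI impI)
  have "continuous_on (cspace n) f"
    using assms by (meson continuous_on_subset entire_UNIV_iff top_greatest)
  thus "continuous_on (cspace n) (restriction n f)"
    by (rule continuous_on_eq) (simp add: restriction_def)
  fix a b assume "a \<in> cspace n" "b \<in> cspace n"
  hence "restriction n f (\<lambda>i. a i + z * b i) = f (\<lambda>i. a i + z * b i)" for z
    by (simp add: restriction_def cspace_def)
  thus "(\<lambda>z. restriction n f (\<lambda>i. a i + z * b i)) holomorphic_on UNIV"
    using assms by (simp add: entire_UNIV_iff)
qed (simp add: restriction_def)

lemma restriction_pullback: "f \<in> cylinder n \<Longrightarrow> restriction n f \<circ> proj n = f"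
  by (auto simp: restriction_def proj_in_cspace cylinder_proj fun_eq_iff)

text \<open>
  Convergence in \<^const>\<open>tau_delta\<close> is hard to test directly. For functions of finitely many
  coordinates it follows from compact convergence, because the pullback is continuous.
\<close>

lemma limitin_tau_zero:
  assumes T: "T = tau_0 \<or> T = tau_delta" and n: "n \<ge> 1"
    and h: "\<And>k. h k \<in> cylinder n"
    and lim: "\<And>R \<epsilon>. \<epsilon> > 0 \<Longrightarrow> \<forall>\<^sub>F k in sequentially. \<forall>x\<in>polydisc n R. norm (h k x) \<le> \<epsilon>"
  shows "limitin T h (\<lambda>x. 0) sequentially"
proof -
  have "limitin (compact_open (cspace n)) (\<lambda>k. restriction n (h k)) (\<lambda>x. 0) sequentially"
    unfolding limitin_def
  proof (intro conjI allI impI)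
    show "(\<lambda>x. 0) \<in> topspace (compact_open (cspace n))"
      using restriction_entire[OF entire_const, of n 0]
      by (simp add: topspace_compact_open restriction_def[abs_def])
    fix U assume "openin (compact_open (cspace n)) U \<and> (\<lambda>x. 0) \<in> U"
    then obtain K \<epsilon> where K: "compact K" "K \<subseteq> cspace n" "0 < \<epsilon>"
        "\<And>f. f \<in> entire (cspace n) \<Longrightarrow> (\<forall>x\<in>K. norm (f x) < \<epsilon>) \<Longrightarrow> f \<in> U"
      using compact_open_zero_nhd by metis
    obtain R where R: "K \<subseteq> polydisc n R" using compact_subset_polydisc[OF K(1,2)] by blast
    have "\<forall>\<^sub>F k in sequentially. \<forall>x\<in>polydisc n R. norm (h k x) \<le> \<epsilon> / 2"
      using lim[of "\<epsilon> / 2" R] K(3) by simp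
    thus "\<forall>\<^sub>F k in sequentially. restriction n (h k) \<in> U"
    proof (rule eventually_mono)
      fix k assume k: "\<forall>x\<in>polydisc n R. norm (h k x) \<le> \<epsilon> / 2"
      have "norm (restriction n (h k) x) < \<epsilon>" if "x \<in> K" for x
        using k that R K(3) by (force simp: restriction_def)
      thus "restriction n (h k) \<in> U"
        by (intro K(4)[OF restriction_entire[OF cylinder_entire[OF h]]]) blast
    qed
  qed
  from continuous_map_limit[OF continuous_map_pullback_tau[OF T n] this]
  show ?thesis using restriction_pullback[OF h] by (simp add: o_def)
qed

locale convolution =
  fixes T :: "((nat \<Rightarrow> complex) \<Rightarrow> complex) topology"
    and L :: "((nat \<Rightarrow> complex) \<Rightarrow> complex) \<Rightarrow> (nat \<Rightarrow> complex) \<Rightarrow> complex"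
  assumes T: "T = tau_0 \<or> T = tau_delta" and L: "convolution_operator T L"
begin

lemma L_entire: "f \<in> entire UNIV \<Longrightarrow> L f \<in> entire UNIV"
  using L topspace_tau[OF T] by (auto simp: convolution_operator_def continuous_map_def)

lemma L_add: "\<lbrakk>f \<in> entire UNIV; g \<in> entire UNIV\<rbrakk> \<Longrightarrow> L (\<lambda>x. f x + g x) = (\<lambda>x. L f x + L g x)"
  and L_scale: "f \<in> entire UNIV \<Longrightarrow> L (\<lambda>x. c * f x) = (\<lambda>x. c * L f x)"
  using L by (auto simp: convolution_operator_def linear_on_funset_def)

text \<open>Translation invariance: \<open>L\<close> is determined by the values of its images at 0.\<close>

lemma L_at:
  assumes "f \<in> entire UNIV"
  shows "L f y = L (\<lambda>x. f (\<lambda>i. x i + y i)) (\<lambda>_. 0)"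
proof -
  have "L (translation (\<lambda>i. - y i) f) = translation (\<lambda>i. - y i) (L f)"
    using L assms by (simp add: convolution_operator_def)
  from fun_cong[OF this, of "\<lambda>_. 0"] show ?thesis by (simp add: translation_def)
qed

text \<open>
  A continuous functional on the functions of \<open>n\<close> coordinates is bounded by a supremum over a
  polydisc: it is smaller than 1 on a basic neighbourhood of the zero function, and rescaling
  does the rest.
\<close>

lemma functional_at_zero:
  assumes n: "n \<ge> 1"
  obtains C R where "R \<ge> 0" "cylinder_functional n (\<lambda>f. L f (\<lambda>_. 0)) C R"
proof -
  have zero: "L (\<lambda>x. 0) = (\<lambda>x. 0)"
    using L_scale[OF entire_const, of 0 0] by simp
  define G where "G g = L (g \<circ> proj n) (\<lambda>_. 0)" for g
  have "continuous_map (compact_open (cspace n)) T (L \<circ> (\<lambda>g. g \<circ> proj n))"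
    using continuous_map_pullback_tau[OF T n] L
    by (intro continuous_map_compose) (auto simp: convolution_operator_def)
  from continuous_map_compose[OF this continuous_map_eval_tau[OF T, of "\<lambda>_. 0"]]
  have "continuous_map (compact_open (cspace n)) euclidean G"
    by (simp add: o_def G_def[abs_def])
  moreover have "openin euclidean (ball (0::complex) 1)" by simp
  ultimately have W: 
    "openin (compact_open (cspace n)) {g \<in> topspace (compact_open (cspace n)). G g \<in> ball 0 1}"
    unfolding continuous_map_def by blast
  have "(\<lambda>x. 0) \<in> {g \<in> topspace (compact_open (cspace n)). G g \<in> ball 0 1}"
    using restriction_entire[OF entire_const, of n 0]
    by (simp add: topspace_compact_open restriction_def[abs_def] G_def o_def zero)
  from compact_open_zero_nhd[OF W this]
  obtain K \<epsilon> where K: "compact K" "K \<subseteq> cspace n" "0 < \<epsilon>"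
      "\<forall>f\<in>entire (cspace n). (\<forall>x\<in>K. norm (f x) < \<epsilon>) \<longrightarrow>
         f \<in> {g \<in> topspace (compact_open (cspace n)). G g \<in> ball 0 1}"
    by blast
  obtain R where R: "R \<ge> 0" "K \<subseteq> polydisc n R" using compact_subset_polydisc[OF K(1,2)] by blast
  have "cylinder_functional n (\<lambda>f. L f (\<lambda>_. 0)) (max 1 (2 / \<epsilon>)) R"
  proof
    fix f g c assume "f \<in> cylinder n"
    thus "L (\<lambda>x. c * f x) (\<lambda>_. 0) = c * L f (\<lambda>_. 0)"
      by (simp add: L_scale cylinder_entire)
    assume "g \<in> cylinder n"
    with \<open>f \<in> cylinder n\<close> show "L (\<lambda>x. f x + g x) (\<lambda>_. 0) = L f (\<lambda>_. 0) + L g (\<lambda>_. 0)"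
      by (simp add: L_add cylinder_entire)
  next
    fix f M assume f: "f \<in> cylinder n" and M: "0 < M" "\<And>x. x \<in> polydisc n R \<Longrightarrow> norm (f x) \<le> M"
    \<comment> \<open>Scaled by \<open>c\<close>, the function \<open>f\<close> falls into the neighbourhood given by \<open>K\<close> and \<open>\<epsilon>\<close>.\<close>
    define c where "c = \<epsilon> / (2 * M)"
    have c: "c > 0" using M K(3) by (simp add: c_def)
    define h where "h = (\<lambda>x. of_real c * f x)"
    have h: "h \<in> cylinder n" unfolding h_def by (intro cylinder_mult cylinder_const f)
    have "norm (restriction n h x) < \<epsilon>" if "x \<in> K" for x
    proof -
      have "norm (h x) \<le> c * M"
        using M(2)[of x] that R c by (auto simp: h_def norm_mult)
      also have "\<dots> < \<epsilon>" using M K(3) by (simp add: c_def)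
      finally show ?thesis using that K(2) by (auto simp: restriction_def)
    qed
    hence "G (restriction n h) \<in> ball 0 1"
      using K(4) restriction_entire[OF cylinder_entire[OF h]] by blast
    hence "norm (L h (\<lambda>_. 0)) < 1" by (simp add: G_def restriction_pullback[OF h])
    hence "c * norm (L f (\<lambda>_. 0)) < 1"
      using c by (simp add: h_def L_scale cylinder_entire[OF f] norm_mult)
    hence "norm (L f (\<lambda>_. 0)) \<le> 2 / \<epsilon> * M"
      using M K(3) by (simp add: c_def field_simps)
    also have "\<dots> \<le> max 1 (2 / \<epsilon>) * M" using M by (intro mult_right_mono) auto
    finally show "norm (L f (\<lambda>_. 0)) \<le> max 1 (2 / \<epsilon>) * M" .
  qed simp
  thus ?thesis using that R(1) by blast
qed

text \<open>
  The symbol of \<open>L\<close> is its eigenvalue on exponentials. If it were constantly \<open>c\<close>, then the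
  functional \<open>f \<mapsto> L f 0 - c * f 0\<close> would vanish on all exponentials, hence by density on all
  functions of finitely many coordinates, and every entire function is one of these. Translations
  extend \<open>L f = c * f\<close> from 0 to every other point.
\<close>

lemma nonconstant_symbol:
  assumes "nontrivial_operator L"
  obtains n a where "n \<ge> 1"
    "L (\<lambda>x. exp (\<Sum>i<n. a i * x i)) (\<lambda>_. 0) \<noteq> L (\<lambda>x. 1) (\<lambda>_. 0)"
proof (rule ccontr)
  define c where "c = L (\<lambda>x. 1) (\<lambda>_. 0)"
  assume "\<not> thesis"
  with that have symbol: "\<And>n a. n \<ge> 1 \<Longrightarrow> L (\<lambda>x. exp (\<Sum>i<n. a i * x i)) (\<lambda>_. 0) = c"
    unfolding c_def by blast
  have at_0: "L f (\<lambda>_. 0) = c * f (\<lambda>_. 0)" if entire_f: "f \<in> entire UNIV" for f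
  proof -
    obtain n where n: "n \<ge> 1" and f: "f \<in> cylinder n"
      using entire_in_cylinder[OF entire_f] by blast
    obtain C R where R: "R \<ge> 0" and C: "cylinder_functional n (\<lambda>f. L f (\<lambda>_. 0)) C R"
      using functional_at_zero[OF n] .
    interpret C: cylinder_functional n "\<lambda>f. L f (\<lambda>_. 0)" C R by (fact C)
    interpret D: cylinder_functional n "\<lambda>f. L f (\<lambda>_. 0) - c * f (\<lambda>_. 0)" "C + norm c" R
    proof
      fix f g assume "f \<in> cylinder n" "g \<in> cylinder n"
      thus "L (\<lambda>x. f x + g x) (\<lambda>_. 0) - c * (f (\<lambda>_. 0) + g (\<lambda>_. 0)) =
          L f (\<lambda>_. 0) - c * f (\<lambda>_. 0) + (L g (\<lambda>_. 0) - c * g (\<lambda>_. 0))"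
        by (simp add: C.add algebra_simps)
    next
      fix f d assume "f \<in> cylinder n"
      thus "L (\<lambda>x. d * f x) (\<lambda>_. 0) - c * (d * f (\<lambda>_. 0)) = d * (L f (\<lambda>_. 0) - c * f (\<lambda>_. 0))"
        by (simp add: C.scale algebra_simps)
    next
      fix f M assume f: "f \<in> cylinder n" "0 < M" "\<And>x. x \<in> polydisc n R \<Longrightarrow> norm (f x) \<le> M"
      have "(\<lambda>_. 0) \<in> polydisc n R" using R by (simp add: polydisc_def cspace_def)
      hence "norm (c * f (\<lambda>_. 0)) \<le> norm c * M"
        using f(3) by (simp add: norm_mult mult_left_mono)
      thus "norm (L f (\<lambda>_. 0) - c * f (\<lambda>_. 0)) \<le> (C + norm c) * M"
        using C.bound[OF f] norm_triangle_ineq4[of "L f (\<lambda>_. 0)" "c * f (\<lambda>_. 0)"]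
        by (simp add: algebra_simps)
    next
      show "1 \<le> C + norm c" using C.C_ge_1 by (simp add: add_increasing2)
    qed
    have "L f (\<lambda>_. 0) - c * f (\<lambda>_. 0) = 0"
    proof (rule D.zero_if_zero_on_exponentials[OF _ f])
      show "L (D.exp_linear a) (\<lambda>_. 0) - c * D.exp_linear a (\<lambda>_. 0) = 0" for a
        using symbol[OF n, of a] by (simp add: D.exp_linear_def[abs_def])
    qed
    thus ?thesis by simp
  qed
  have "L f = (\<lambda>x. c * f x)" if "f \<in> entire UNIV" for f
  proof
    fix x
    have "(\<lambda>y. f (\<lambda>i. y i + x i)) \<in> entire UNIV"
      using entire_translation[OF that, of "\<lambda>i. - x i"] by (simp add: translation_def)
    from at_0[OF this] show "L f x = c * f x" by (simp add: L_at[OF that, of x])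
  qed
  thus False using assms by (auto simp: nontrivial_operator_def)
qed

text \<open>
  Choose a linear form \<open>\<phi>\<close> along which the symbol is not constant. By translation invariance \<open>L\<close> maps
  functions of the form \<open>g \<circ> \<phi>\<close> to functions of the same form, so it induces an operator \<open>A\<close> on
  entire functions of one variable. Its exponential eigenvalues \<open>\<Psi>\<close> form a nonconstant entire
  function, which takes values inside and outside the unit circle.
\<close>

theorem semi_irregular_function:
  assumes "nontrivial_operator L"
  obtains f where "f \<in> entire UNIV"
    "\<And>d. d \<noteq> 0 \<Longrightarrow> li_yorke_pair T L (\<lambda>x. d * f x) (\<lambda>x. 0)"
proof -
  obtain n \<alpha> where n: "n \<ge> 1"
    and symbol: "L (\<lambda>x. exp (\<Sum>i<n. \<alpha> i * x i)) (\<lambda>_. 0) \<noteq> L (\<lambda>x. 1) (\<lambda>_. 0)"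
    using nonconstant_symbol[OF assms] .
  obtain C R where R: "R \<ge> 0" and C: "cylinder_functional n (\<lambda>f. L f (\<lambda>_. 0)) C R"
    using functional_at_zero[OF n] .
  interpret C: cylinder_functional n "\<lambda>f. L f (\<lambda>_. 0)" C R by (fact C)
  define \<phi> where "\<phi> x = (\<Sum>i<n. \<alpha> i * x i)" for x :: "nat \<Rightarrow> complex"
  have \<phi>: "\<phi> \<in> cylinder n"
    unfolding \<phi>_def[abs_def] by (intro cylinder_sum cylinder_mult cylinder_const cylinder_coord) auto
  have \<phi>_add: "\<phi> (\<lambda>i. x i + y i) = \<phi> x + \<phi> y"
    and \<phi>_diff: "\<phi> (\<lambda>i. x i - y i) = \<phi> x - \<phi> y"
    and \<phi>_scale: "\<phi> (\<lambda>i. c * x i) = c * \<phi> x" for x y c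
    by (simp_all add: \<phi>_def sum.distrib sum_subtractf sum_distrib_left algebra_simps)
  obtain i0 where i0: "i0 < n" "\<alpha> i0 \<noteq> 0"
  proof (rule ccontr)
    assume "\<not> thesis"
    with that have "\<And>i. i < n \<Longrightarrow> \<alpha> i = 0" by blast
    thus False using symbol by simp
  qed
  \<comment> \<open>A vector with \<open>\<phi> e = 1\<close>: the values of a function of \<open>\<phi>\<close> can be read off along its multiples.\<close>
  define e where "e i = (if i = i0 then 1 / \<alpha> i0 else 0)" for i
  have "\<phi> e = (\<Sum>i<n. if i = i0 then 1 else 0)"
    unfolding \<phi>_def e_def using i0(2) by (intro sum.cong) auto
  hence \<phi>e: "\<phi> (\<lambda>i. t * e i) = t" for t using i0(1) by (simp add: \<phi>_scale)
  have comp: "(\<lambda>x. g (\<phi> x)) \<in> cylinder n" if "g holomorphic_on UNIV" for g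
    by (rule cylinder_compose_holomorphic[OF that \<phi>])
  note comp_entire = cylinder_entire[OF comp]
  define A where "A g t = L (\<lambda>x. g (\<phi> x)) (\<lambda>i. t * e i)" for g t
  have A_shift: "A g t = L (\<lambda>x. g (\<phi> x + t)) (\<lambda>_. 0)" if "g holomorphic_on UNIV" for g t
    unfolding A_def by (subst L_at[OF comp_entire[OF that]]) (simp add: \<phi>_add \<phi>e)
  have semiconj: "L (\<lambda>x. g (\<phi> x)) = (\<lambda>x. A g (\<phi> x))" if "g holomorphic_on UNIV" for g
  proof
    fix x
    have "L (\<lambda>x. g (\<phi> x)) x = L (\<lambda>y. g (\<phi> y + \<phi> x)) (\<lambda>_. 0)"
      by (subst L_at[OF comp_entire[OF that]]) (simp add: \<phi>_add)
    thus "L (\<lambda>x. g (\<phi> x)) x = A g (\<phi> x)" by (simp add: A_shift[OF that])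
  qed
  obtain B where B: "B > 0" "\<And>x. x \<in> polydisc n R \<Longrightarrow> norm (\<phi> x) \<le> B"
    using polydisc_bound[OF cylinder_entire[OF \<phi>], of n R] by blast
  define \<Psi> where "\<Psi> z = L (\<lambda>x. exp (z * \<phi> x)) (\<lambda>_. 0)" for z
  have "(\<Psi> has_field_derivative L (\<lambda>x. 1 * \<phi> x * exp (z * \<phi> x)) (\<lambda>_. 0)) (at z)" for z
    using C.has_field_derivative_exp[OF cylinder_const \<phi>, of 1 z] by (simp add: \<Psi>_def[abs_def])
  hence hol_\<Psi>: "\<Psi> holomorphic_on UNIV"
    by (auto simp: holomorphic_on_open)
  have "\<Psi> 1 \<noteq> \<Psi> 0" using symbol by (simp add: \<Psi>_def \<phi>_def)
  from nonconstant_entire_crosses_unit_circle[OF hol_\<Psi> this]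
  obtain a b where ab: "norm (\<Psi> a) < 1" "norm (\<Psi> b) > 1" .
  interpret A: exponential_eigenvectors A C B \<Psi> a b
  proof
    fix g :: "complex \<Rightarrow> complex" assume g: "g holomorphic_on UNIV"
    have "L (\<lambda>x. g (\<phi> x)) \<in> entire UNIV" by (intro L_entire comp_entire g)
    from this[unfolded entire_UNIV_iff, THEN conjunct2, THEN spec, THEN spec, of "\<lambda>_. 0" e]
    show "A g holomorphic_on UNIV" by (simp add: A_def[abs_def])
    show "A (\<lambda>t. c * g t) = (\<lambda>t. c * A g t)" for c
      by (simp add: A_def[abs_def] L_scale[OF comp_entire[OF g]])
    show "A (\<lambda>t. g t + f t) = (\<lambda>t. A g t + A f t)" if "f holomorphic_on UNIV" for f
      by (simp add: A_def[abs_def] L_add[OF comp_entire[OF g] comp_entire[OF that]])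
    show "norm (A g t) \<le> C * M" if "0 < M" "\<And>s. norm (s - t) \<le> B \<Longrightarrow> norm (g s) \<le> M" for M t
      unfolding A_shift[OF g]
    proof (rule C.bound[OF _ that(1)])
      have "(\<lambda>s. s + t) holomorphic_on UNIV" by (intro holomorphic_intros)
      hence "(\<lambda>s. g (s + t)) holomorphic_on UNIV"
        using holomorphic_on_compose_gen[of "\<lambda>s. s + t" UNIV g UNIV] g by (simp add: o_def)
      thus "(\<lambda>x. g (\<phi> x + t)) \<in> cylinder n" by (rule comp)
      show "norm (g (\<phi> x + t)) \<le> M" if "x \<in> polydisc n R" for x
        using B(2)[OF that] \<open>\<And>s. norm (s - t) \<le> B \<Longrightarrow> norm (g s) \<le> M\<close> by simp
    qed
  next
    show "1 \<le> C" by (rule C.C_ge_1)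
    show "0 \<le> B" using B by simp
    show "norm (\<Psi> a) < 1" "1 < norm (\<Psi> b)" by (fact ab)+
    show "continuous_on UNIV \<Psi>" using hol_\<Psi> by (rule holomorphic_on_imp_continuous_on)
    show "A (\<lambda>t. exp (z * t)) = (\<lambda>t. \<Psi> z * exp (z * t))" for z
    proof
      fix t
      have "(\<lambda>t. exp (z * t)) holomorphic_on UNIV" by (intro holomorphic_intros)
      hence "A (\<lambda>t. exp (z * t)) t = L (\<lambda>x. exp (z * (\<phi> x + t))) (\<lambda>_. 0)"
        by (rule A_shift)
      also have "(\<lambda>x. exp (z * (\<phi> x + t))) = (\<lambda>x. exp (z * t) * exp (z * \<phi> x))"
        by (simp add: algebra_simps flip: exp_add)
      also have "L \<dots> (\<lambda>_. 0) = exp (z * t) * \<Psi> z"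
        unfolding \<Psi>_def
        by (rule C.scale) (intro cylinder_exp cylinder_mult cylinder_const \<phi>)
      finally show "A (\<lambda>t. exp (z * t)) t = \<Psi> z * exp (z * t)" by simp
    qed
  qed
  obtain g \<kappa> where g: "g holomorphic_on UNIV" "\<not> (\<lambda>k. (A ^^ k) g 0) \<longlonglongrightarrow> 0"
    and \<kappa>: "strict_mono \<kappa>"
      "\<And>R \<epsilon>. \<epsilon> > 0 \<Longrightarrow> \<forall>\<^sub>F j in sequentially. \<forall>t. norm t \<le> R \<longrightarrow> norm ((A ^^ \<kappa> j) g t) \<le> \<epsilon>"
    using A.semi_irregular_vector by blast
  have iter: "(L ^^ k) (\<lambda>x. d * g (\<phi> x)) = (\<lambda>x. d * (A ^^ k) g (\<phi> x))" for k d
  proof (induction k)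
    case (Suc k)
    thus ?case
      by (simp add: L_scale comp_entire A.iter_holo g(1) semiconj)
  qed simp
  show ?thesis
  proof (rule that)
    show "(\<lambda>x. g (\<phi> x)) \<in> entire UNIV" by (rule comp_entire[OF g(1)])
    fix d :: complex assume d: "d \<noteq> 0"
    have "\<not> limitin T (\<lambda>k. (L ^^ k) (\<lambda>x. d * g (\<phi> x))) (\<lambda>x. 0) sequentially"
    proof
      assume "limitin T (\<lambda>k. (L ^^ k) (\<lambda>x. d * g (\<phi> x))) (\<lambda>x. 0) sequentially"
      from continuous_map_limit[OF continuous_map_eval_tau[OF T, of "\<lambda>_. 0"] this]
      have "(\<lambda>k. d * (A ^^ k) g 0) \<longlonglongrightarrow> 0"
        using \<phi>_scale[of 0 "\<lambda>_. 0"] by (simp add: iter o_def)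
      hence "(\<lambda>k. inverse d * (d * (A ^^ k) g 0)) \<longlonglongrightarrow> 0" by (rule tendsto_mult_right_zero)
      thus False using g(2) d by (simp flip: mult.assoc)
    qed
    moreover have "limitin T (\<lambda>j. (L ^^ \<kappa> j) (\<lambda>x. d * g (\<phi> x))) (\<lambda>x. 0) sequentially"
      unfolding iter
    proof (rule limitin_tau_zero[OF T n])
      show "(\<lambda>x. d * (A ^^ \<kappa> k) g (\<phi> x)) \<in> cylinder n" for k
        by (intro cylinder_mult cylinder_const comp A.iter_holo g)
      fix R \<epsilon> :: real assume \<epsilon>: "\<epsilon> > 0"
      obtain B where B: "\<And>x. x \<in> polydisc n R \<Longrightarrow> norm (\<phi> x) \<le> B"
        using polydisc_bound[OF cylinder_entire[OF \<phi>], of n R] by blast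
      have "\<epsilon> / norm d > 0" using \<epsilon> d by simp
      from \<kappa>(2)[OF this, of B]
      show "\<forall>\<^sub>F k in sequentially. \<forall>x\<in>polydisc n R. norm (d * (A ^^ \<kappa> k) g (\<phi> x)) \<le> \<epsilon>"
      proof (rule eventually_mono)
        fix k assume "\<forall>t. norm t \<le> B \<longrightarrow> norm ((A ^^ \<kappa> k) g t) \<le> \<epsilon> / norm d"
        thus "\<forall>x\<in>polydisc n R. norm (d * (A ^^ \<kappa> k) g (\<phi> x)) \<le> \<epsilon>"
          using B d by (auto simp: norm_mult field_simps)
      qed
    qed
    ultimately show "li_yorke_pair T L (\<lambda>x. d * g (\<phi> x)) (\<lambda>x. 0)"
      using \<kappa>(1) by (auto simp: li_yorke_pair_def)
  qed
qed

end

section \<open>Li-Yorke chaos\<close>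

text \<open>
  The differences of distinct real multiples of one semi-irregular function are nonzero multiples
  of it, so all these multiples form a scrambled set.
\<close>

theorem theorem3p2:
  fixes T :: "((nat \<Rightarrow> complex) \<Rightarrow> complex) topology"
    and L :: "((nat \<Rightarrow> complex) \<Rightarrow> complex) \<Rightarrow> (nat \<Rightarrow> complex) \<Rightarrow> complex"
  assumes "T = tau_0 \<or> T = tau_delta"
    and "convolution_operator T L"
    and "nontrivial_operator L"
  shows "li_yorke_chaotic T L"
proof -
  interpret convolution T L by unfold_locales (fact assms)+
  obtain f where f: "f \<in> entire UNIV"
    and pair: "\<And>d. d \<noteq> 0 \<Longrightarrow> li_yorke_pair T L (\<lambda>x. d * f x) (\<lambda>x. 0)"
    using semi_irregular_function[OF assms(3)] by blast
  define S where "S = range (\<lambda>c::real. \<lambda>x. of_real c * f x)"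
  have "f \<noteq> (\<lambda>x. 0)"
  proof
    assume f0: "f = (\<lambda>x. 0)"
    have "(L ^^ k) (\<lambda>x. 0) = (\<lambda>x. 0)" for k
      using L_scale[OF entire_const, of 0 0] by (induction k) simp_all
    moreover have "limitin T (\<lambda>k. \<lambda>x. 0) (\<lambda>x. 0) sequentially"
      using entire_const topspace_tau[OF assms(1)] by (simp add: limitin_const_iff)
    ultimately show False using pair[of 1] by (simp add: li_yorke_pair_def f0)
  qed
  then obtain x where "f x \<noteq> 0" by blast
  hence "inj (\<lambda>c::real. \<lambda>x. of_real c * f x)"
    by (auto simp: inj_def dest: fun_cong[where x = x])
  hence "uncountable S"
    unfolding S_def using uncountable_UNIV_real countable_image_inj_eq by blast
  moreover have "scrambled_set T L S"
    unfolding scrambled_set_def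
  proof (intro conjI ballI impI)
    show "S \<subseteq> topspace T"
      unfolding S_def topspace_tau[OF assms(1)] using f by (auto intro: entire_mult entire_const)
    fix g h assume "g \<in> S" "h \<in> S" "g \<noteq> h"
    then obtain c d :: real where "g = (\<lambda>x. of_real c * f x)" "h = (\<lambda>x. of_real d * f x)" "c \<noteq> d"
      by (auto simp: S_def)
    hence "(\<lambda>x. g x - h x) = (\<lambda>x. (of_real (c - d) * f x) - 0)" "of_real (c - d) \<noteq> (0::complex)"
      by (simp_all add: algebra_simps)
    with pair[of "of_real (c - d)"] show "li_yorke_pair T L g h"
      unfolding li_yorke_pair_def by simp
  qed
  ultimately show ?thesis by (auto simp: li_yorke_chaotic_def)
qed

end
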